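(* Given a metric of doubling dimension $d$ (on $n$ points), an integer $k$, and $\varepsilon>0$, a $(1+\varepsilon)$-approximate solution to $k$-Center can be computed in time $(k^k/\varepsilon^{O(kd)})\cdot n^{O(1)}$.
   Context: $k$-Center on a metric $(V,\mathrm{dist})$ (e.g. the shortest-path metric of a graph with positive edge lengths): find $C\subseteq V$ with $|C|\le k$ minimizing $\max_{u\in V}\min_{v\in C}\mathrm{dist}(u,v)$. A $(1+\varepsilon)$-approximate solution is a feasible $C$ whose cost is at most $1+\varepsilon$ times the optimum. The doubling dimension of a metric $(X,\mathrm{dist})$ is the smallest $d\in\mathbb{R}$ such that for every $r>0$, every ball of radius $2r$ is contained in the union of at most $2^d$ balls of radius $r$.
   Formalization: In the running time the base ε of ε^{O(kd)} is replaced by min(ε,1/2), since read literally the bound falls below one step for large ε; the (1+ε)-approximation itself is still claimed for every ε>0, and nothing changes for ε≤1/2. *)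

theory Defs
  imports "HOL-Analysis.Analysis"
begin

text \<open>
  Doubling dimension of a metric space. Balls are closed and have their centers in the space. For a
  finite space, replacing closed balls by open ones throughout does not change the dimension.
\<close>

definition doubling_bound :: "'a set \<Rightarrow> ('a \<Rightarrow> 'a \<Rightarrow> real) \<Rightarrow> real \<Rightarrow> bool" where
  "doubling_bound V \<rho> \<delta> \<longleftrightarrow>
     (\<forall>r>0. \<forall>x\<in>V. \<exists>C. finite C \<and> C \<subseteq> V \<and> real (card C) \<le> 2 powr \<delta> \<and>
        Metric_space.mcball V \<rho> x (2 * r) \<subseteq> (\<Union>c\<in>C. Metric_space.mcball V \<rho> c r))"

definition doubling_dimension :: "'a set \<Rightarrow> ('a \<Rightarrow> 'a \<Rightarrow> real) \<Rightarrow> real" where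
  "doubling_dimension V \<rho> = (LEAST \<delta>. doubling_bound V \<rho> \<delta>)"

text \<open>The minimum is attained, so that the operator \<open>LEAST\<close> is meaningful on finite metrics.\<close>

lemma doubling_dimension_least:
  assumes M: "Metric_space V \<rho>" and fin: "finite V" and ne: "V \<noteq> {}"
  shows "doubling_bound V \<rho> (doubling_dimension V \<rho>)"
    and "\<And>\<delta>. doubling_bound V \<rho> \<delta> \<Longrightarrow> doubling_dimension V \<rho> \<le> \<delta>"
proof -
  interpret Metric_space V \<rho> by (rule M)
  define Q where "Q m \<longleftrightarrow> (\<forall>r>0. \<forall>x\<in>V. \<exists>C. finite C \<and> C \<subseteq> V \<and> card C \<le> m \<and>
        mcball x (2 * r) \<subseteq> (\<Union>c\<in>C. mcball c r))" for m :: nat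
  have Q_card: "Q (card V)"
    unfolding Q_def
  proof (intro allI impI ballI)
    fix r :: real and x assume "r > 0" "x \<in> V"
    have "mcball x (2 * r) \<subseteq> (\<Union>c\<in>V. mcball c r)"
    proof
      fix y assume "y \<in> mcball x (2 * r)"
      then have "y \<in> V" by simp
      moreover from this \<open>r > 0\<close> have "y \<in> mcball y r" by simp
      ultimately show "y \<in> (\<Union>c\<in>V. mcball c r)" by (rule UN_I)
    qed
    then show "\<exists>C. finite C \<and> C \<subseteq> V \<and> card C \<le> card V \<and> mcball x (2 * r) \<subseteq> (\<Union>c\<in>C. mcball c r)"
      using fin by (intro exI[of _ V]) simp
  qed
  define m where "m = (LEAST m. Q m)"
  have Qm: "Q m" unfolding m_def by (rule LeastI[of Q, OF Q_card])
  have Q_mono: "Q j" if "Q i" "i \<le> j" for i j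
    unfolding Q_def
  proof (intro allI impI ballI)
    fix r :: real and x assume "r > 0" "x \<in> V"
    with \<open>Q i\<close> obtain C where
      "finite C \<and> C \<subseteq> V \<and> card C \<le> i \<and> mcball x (2 * r) \<subseteq> (\<Union>c\<in>C. mcball c r)"
      unfolding Q_def by metis
    with \<open>i \<le> j\<close> show
      "\<exists>C. finite C \<and> C \<subseteq> V \<and> card C \<le> j \<and> mcball x (2 * r) \<subseteq> (\<Union>c\<in>C. mcball c r)"
      by (intro exI[of _ C]) linarith
  qed
  have Q_iff: "Q j \<longleftrightarrow> m \<le> j" for j
  proof
    show "Q j \<Longrightarrow> m \<le> j" unfolding m_def by (rule Least_le)
    show "m \<le> j \<Longrightarrow> Q j" by (rule Q_mono[OF Qm])
  qed
  have "\<not> Q 0"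
  proof
    assume "Q 0"
    obtain x where "x \<in> V" using ne by blast
    have "\<exists>C. finite C \<and> C \<subseteq> V \<and> card C \<le> 0 \<and> mcball x (2 * 1) \<subseteq> (\<Union>c\<in>C. mcball c 1)"
      using \<open>Q 0\<close>[unfolded Q_def, rule_format, OF zero_less_one \<open>x \<in> V\<close>] .
    then have "mcball x 2 \<subseteq> {}" by auto
    moreover have "x \<in> mcball x 2" using \<open>x \<in> V\<close> by simp
    ultimately show False by blast
  qed
  then have m_pos: "m > 0" using Qm by (cases m) auto
  have iff: "doubling_bound V \<rho> \<delta> \<longleftrightarrow> log 2 (real m) \<le> \<delta>" for \<delta>
  proof -
    have le: "real i \<le> 2 powr \<delta> \<longleftrightarrow> i \<le> nat \<lfloor>2 powr \<delta>\<rfloor>" for i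
      by (simp add: le_nat_iff le_floor_iff)
    have "doubling_bound V \<rho> \<delta> \<longleftrightarrow> Q (nat \<lfloor>2 powr \<delta>\<rfloor>)"
      unfolding doubling_bound_def Q_def le by simp
    also have "\<dots> \<longleftrightarrow> real m \<le> 2 powr \<delta>" by (simp add: Q_iff le)
    also have "\<dots> \<longleftrightarrow> log 2 (real m) \<le> \<delta>" using m_pos by (simp add: log_le_iff)
    finally show ?thesis .
  qed
  have eq: "doubling_dimension V \<rho> = log 2 (real m)"
    unfolding doubling_dimension_def iff by (rule Least_equality) auto
  show "doubling_bound V \<rho> (doubling_dimension V \<rho>)" by (simp add: eq iff)
  show "doubling_dimension V \<rho> \<le> \<delta>" if "doubling_bound V \<rho> \<delta>" for \<delta>
    using that by (simp add: eq iff)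
qed


text \<open>
  Centers must be nonempty: with no centers the cost is infinite, whereas \<open>Min {}\<close> is an
  unspecified real number.
\<close>

definition kcenter_feasible :: "'a set \<Rightarrow> nat \<Rightarrow> 'a set \<Rightarrow> bool" where
  "kcenter_feasible V k C \<longleftrightarrow> C \<subseteq> V \<and> C \<noteq> {} \<and> card C \<le> k"

definition kcenter_cost :: "'a set \<Rightarrow> ('a \<Rightarrow> 'a \<Rightarrow> real) \<Rightarrow> 'a set \<Rightarrow> real" where
  "kcenter_cost V \<rho> C = (MAX u\<in>V. MIN v\<in>C. \<rho> u v)"

definition kcenter_opt :: "'a set \<Rightarrow> ('a \<Rightarrow> 'a \<Rightarrow> real) \<Rightarrow> nat \<Rightarrow> real" where
  "kcenter_opt V \<rho> k = Min (kcenter_cost V \<rho> ` {C. kcenter_feasible V k C})"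

definition kcenter_approx :: "'a set \<Rightarrow> ('a \<Rightarrow> 'a \<Rightarrow> real) \<Rightarrow> nat \<Rightarrow> real \<Rightarrow> 'a set \<Rightarrow> bool" where
  "kcenter_approx V \<rho> k \<epsilon> C \<longleftrightarrow>
     kcenter_feasible V k C \<and> kcenter_cost V \<rho> C \<le> (1 + \<epsilon>) * kcenter_opt V \<rho> k"


text \<open>
  The machine model is the real RAM with unit costs. Natural numbers, used for counting and
  addressing, and reals live in separate registers and arrays. A program mentions only finitely many
  registers and arrays, and array cells are accessed through an index held in a register.

  Natural numbers have only addition and truncated subtraction, since multiplication or shifts
  on unbounded integers at unit cost would make the model unreasonably strong. Reals have
  the field operations and comparisons, with no rounding and no way to
  turn a real into a natural number other than by comparisons; real constants in programs are
  natural numbers. Division by zero yields zero, as in the library.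
\<close>

datatype instr =
    NConst nat nat            \<comment> \<open>target register, value\<close>
  | NAdd nat nat nat          \<comment> \<open>target register, operand registers\<close>
  | NSub nat nat nat
  | NLoad nat nat nat         \<comment> \<open>target register, array, index register\<close>
  | NStore nat nat nat        \<comment> \<open>array, index register, source register\<close>
  | RConst nat nat
  | RAdd nat nat nat
  | RSub nat nat nat
  | RMul nat nat nat
  | RDiv nat nat nat
  | RLoad nat nat nat
  | RStore nat nat nat

datatype test =
    NLess nat nat
  | NLe nat nat
  | RLess nat nat
  | RLe nat nat

datatype prog =
    Instr instr
  | Seq prog prog
  | Cond test prog prog
  | While test prog

record store =
  nreg :: "nat \<Rightarrow> nat"
  rreg :: "nat \<Rightarrow> real"
  narr :: "nat \<Rightarrow> nat \<Rightarrow> nat"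
  rarr :: "nat \<Rightarrow> nat \<Rightarrow> real"

definition set_nreg :: "nat \<Rightarrow> nat \<Rightarrow> store \<Rightarrow> store" where
  "set_nreg x v s = s\<lparr>nreg := (nreg s)(x := v)\<rparr>"

definition set_rreg :: "nat \<Rightarrow> real \<Rightarrow> store \<Rightarrow> store" where
  "set_rreg x v s = s\<lparr>rreg := (rreg s)(x := v)\<rparr>"

definition set_narr :: "nat \<Rightarrow> nat \<Rightarrow> nat \<Rightarrow> store \<Rightarrow> store" where
  "set_narr a i v s = s\<lparr>narr := (narr s)(a := (narr s a)(i := v))\<rparr>"

definition set_rarr :: "nat \<Rightarrow> nat \<Rightarrow> real \<Rightarrow> store \<Rightarrow> store" where
  "set_rarr a i v s = s\<lparr>rarr := (rarr s)(a := (rarr s a)(i := v))\<rparr>"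

fun exec_instr :: "instr \<Rightarrow> store \<Rightarrow> store" where
  "exec_instr (NConst x m) s = set_nreg x m s"
| "exec_instr (NAdd x y z) s = set_nreg x (nreg s y + nreg s z) s"
| "exec_instr (NSub x y z) s = set_nreg x (nreg s y - nreg s z) s"
| "exec_instr (NLoad x a i) s = set_nreg x (narr s a (nreg s i)) s"
| "exec_instr (NStore a i x) s = set_narr a (nreg s i) (nreg s x) s"
| "exec_instr (RConst x m) s = set_rreg x (real m) s"
| "exec_instr (RAdd x y z) s = set_rreg x (rreg s y + rreg s z) s"
| "exec_instr (RSub x y z) s = set_rreg x (rreg s y - rreg s z) s"
| "exec_instr (RMul x y z) s = set_rreg x (rreg s y * rreg s z) s"
| "exec_instr (RDiv x y z) s = set_rreg x (rreg s y / rreg s z) s"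
| "exec_instr (RLoad x a i) s = set_rreg x (rarr s a (nreg s i)) s"
| "exec_instr (RStore a i x) s = set_rarr a (nreg s i) (rreg s x) s"

fun eval_test :: "test \<Rightarrow> store \<Rightarrow> bool" where
  "eval_test (NLess x y) s \<longleftrightarrow> nreg s x < nreg s y"
| "eval_test (NLe x y) s \<longleftrightarrow> nreg s x \<le> nreg s y"
| "eval_test (RLess x y) s \<longleftrightarrow> rreg s x < rreg s y"
| "eval_test (RLe x y) s \<longleftrightarrow> rreg s x \<le> rreg s y"

text \<open>
  \<open>runs p s t s'\<close>: started in \<open>s\<close>, the program \<open>p\<close> halts in \<open>s'\<close> after executing exactly \<open>t\<close>
  instructions and tests.
\<close>

inductive runs :: "prog \<Rightarrow> store \<Rightarrow> nat \<Rightarrow> store \<Rightarrow> bool" where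
  runs_Instr: "runs (Instr c) s 1 (exec_instr c s)"
| runs_Seq: "runs p s t s' \<Longrightarrow> runs q s' t' s'' \<Longrightarrow> runs (Seq p q) s (t + t') s''"
| runs_Cond_True: "eval_test b s \<Longrightarrow> runs p s t s' \<Longrightarrow> runs (Cond b p q) s (Suc t) s'"
| runs_Cond_False: "\<not> eval_test b s \<Longrightarrow> runs q s t s' \<Longrightarrow> runs (Cond b p q) s (Suc t) s'"
| runs_While_True: "eval_test b s \<Longrightarrow> runs p s t s' \<Longrightarrow> runs (While b p) s' t' s'' \<Longrightarrow>
    runs (While b p) s (Suc (t + t')) s''"
| runs_While_False: "\<not> eval_test b s \<Longrightarrow> runs (While b p) s 1 s"

inductive_cases runs_InstrE: "runs (Instr c) s t s'"
inductive_cases runs_SeqE: "runs (Seq p q) s t s'"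
inductive_cases runs_CondE: "runs (Cond b p q) s t s'"
inductive_cases runs_WhileE: "runs (While b p) s t s'"

lemma runs_deterministic:
  "runs p s t s' \<Longrightarrow> runs p s u r \<Longrightarrow> u = t \<and> r = s'"
proof (induction arbitrary: u r rule: runs.induct)
  case (runs_Instr c s)
  then show ?case by (rule runs_InstrE) simp
next
  case (runs_Seq p s t s' q t' s'')
  from runs_Seq.prems show ?case
  proof (rule runs_SeqE)
    fix v w v' assume *: "u = v + v'" "runs p s v w" "runs q w v' r"
    with runs_Seq.IH(1) have "v = t" "w = s'" by blast+
    with * runs_Seq.IH(2) show ?case by blast
  qed
next
  case (runs_Cond_True b s p t s' q)
  from runs_Cond_True.prems show ?case
  proof (rule runs_CondE)
    fix v assume "u = Suc v" "runs p s v r"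
    with runs_Cond_True.IH show ?case by blast
  qed (use runs_Cond_True.hyps(1) in simp)
next
  case (runs_Cond_False b s q t s' p)
  from runs_Cond_False.prems show ?case
  proof (rule runs_CondE)
    fix v assume "u = Suc v" "runs q s v r"
    with runs_Cond_False.IH show ?case by blast
  qed (use runs_Cond_False.hyps(1) in simp)
next
  case (runs_While_True b s p t s' t' s'')
  from runs_While_True.prems show ?case
  proof (rule runs_WhileE)
    fix v w v' assume *: "u = Suc (v + v')" "runs p s v w" "runs (While b p) w v' r"
    with runs_While_True.IH(1) have "v = t" "w = s'" by blast+
    with * runs_While_True.IH(2) show ?case by blast
  qed (use runs_While_True.hyps(1) in simp)
next
  case (runs_While_False b s p)
  from runs_While_False.prems show ?case
    by (rule runs_WhileE) (use runs_While_False.hyps in simp_all)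
qed

text \<open>
  Input: the number of points and \<open>k\<close> in the first two natural registers, \<open>\<epsilon>\<close> in a real register, and
  the distance matrix of the points \<open>0, \<dots>, n - 1\<close> in row-major order. The doubling dimension is not
  part of the input. Output: the number of listed centers in a register, and their list in an array.
\<close>

definition kcenter_input :: "nat \<Rightarrow> (nat \<Rightarrow> nat \<Rightarrow> real) \<Rightarrow> nat \<Rightarrow> real \<Rightarrow> store" where
  "kcenter_input n \<rho> k \<epsilon> =
     \<lparr>nreg = (\<lambda>_. 0)(0 := n, 1 := k),
      rreg = (\<lambda>_. 0)(0 := \<epsilon>),
      narr = (\<lambda>_ _. 0),
      rarr = (\<lambda>a i. if a = 0 \<and> i < n * n then \<rho> (i div n) (i mod n) else 0)\<rparr>"

definition kcenter_output :: "store \<Rightarrow> nat set" where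
  "kcenter_output s = narr s 0 ` {..<nreg s 0}"

text \<open>
  The running time \<open>(k^k / \<epsilon>^O(k d)) n^O(1)\<close> with explicit constants: \<open>a\<close> is hidden in \<open>O(k d)\<close>,
  and \<open>b\<close> and \<open>c\<close> in \<open>n^O(1)\<close>. As usual, \<open>\<epsilon>^O(k d)\<close> refers to small \<open>\<epsilon>\<close>: the base is capped at
  \<open>1/2\<close>, because powers of \<open>1/\<epsilon>\<close> with \<open>\<epsilon>\<close> near \<open>1\<close> cannot absorb the factor \<open>2^O(k d)\<close>, and for
  \<open>\<epsilon> > 1\<close> they would even tend to \<open>0\<close> with growing \<open>a\<close>. For \<open>\<epsilon> \<le> 1/2\<close> the cap is void.
\<close>

definition kcenter_time_bound :: "real \<Rightarrow> real \<Rightarrow> real \<Rightarrow> nat \<Rightarrow> nat \<Rightarrow> real \<Rightarrow> real \<Rightarrow> real" where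
  "kcenter_time_bound a b c n k \<epsilon> d =
     (real k ^ k / (min \<epsilon> (1 / 2)) powr (a * real k * d)) * (b * real n powr c)"

end

theory Submission
  imports Defs
begin

text \<open>
  Farthest-first traversal until there are \<open>min k n\<close> points yields a solution of some cost
  \<open>R \<le> 2 * OPT\<close>: together with the next farthest point these are \<open>min k n + 1\<close> points at pairwise distance
  at least \<open>R\<close>, two of which share an optimal center. Continuing the traversal until the
  covering radius is at most \<open>T = \<epsilon> * R / 2 \<le> \<epsilon> * OPT\<close> gives a net whose points have pairwise distance above \<open>T\<close>
  (unless no point was added). Moving every optimal center to the nearest net point costs at most \<open>T\<close>, so
  it suffices to try all \<open>k\<close>-tuples of net points, enumerated by an odometer. The net lies in
  \<open>k\<close> balls of radius \<open>R\<close>; halving the radius \<open>j\<close> times, with \<open>4 / \<epsilon> \<le> 2 ^ j \<le> 8 / \<epsilon>\<close>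
  for \<open>\<epsilon> \<le> 1 / 2\<close>, leaves at most one net point per ball, so that the net has at most
  \<open>k * (8 / \<epsilon>) powr d\<close> points, and \<open>8 / \<epsilon> \<le> (1 / \<epsilon>) ^ 4\<close>. The program never needs to know \<open>d\<close>.
\<close>

section \<open>Time-bounded execution\<close>

text \<open>Total correctness with a time budget. As \<open>Q\<close> may be any predicate on
  stores, a sequential composition is handled by taking \<open>runs_within\<close> of the second
  program as the postcondition of the first.\<close>

definition runs_within :: "prog \<Rightarrow> store \<Rightarrow> nat \<Rightarrow> (store \<Rightarrow> bool) \<Rightarrow> bool" where
  "runs_within p s T Q \<longleftrightarrow> (\<exists>t s'. runs p s t s' \<and> t \<le> T \<and> Q s')"

text \<open>The language has no skip, so the empty block is a loop whose test never holds. That test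
  costs one step, whence blocks take \<open>length cs + 1\<close> steps.\<close>

primrec block :: "instr list \<Rightarrow> prog" where
  "block [] = While (NLess 0 0) (Instr (NConst 0 0))"
| "block (c # cs) = Seq (Instr c) (block cs)"

lemma runs_within_mono:
  "runs_within p s T Q \<Longrightarrow> T \<le> T' \<Longrightarrow> (\<And>s'. Q s' \<Longrightarrow> Q' s') \<Longrightarrow> runs_within p s T' Q'"
  unfolding runs_within_def by (meson order_trans)

lemma runs_block: "runs (block cs) s (length cs + 1) (fold exec_instr cs s)"
proof (induction cs arbitrary: s)
  case Nil
  then show ?case using runs_While_False[of "NLess 0 0" s] by simp
next
  case (Cons c cs)
  then show ?case using runs_Seq[OF runs_Instr Cons.IH] by simp
qed

lemma runs_within_block: "Q (fold exec_instr cs s) \<Longrightarrow> length cs < T \<Longrightarrow> runs_within (block cs) s T Q"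
  unfolding runs_within_def using runs_block[of cs s] by (metis Suc_eq_plus1 Suc_leI)

lemma runs_within_Seq:
  assumes "runs_within p s T1 (\<lambda>s'. runs_within q s' T2 Q)" "T1 + T2 \<le> T"
  shows "runs_within (Seq p q) s T Q"
proof -
  obtain t s' where 1: "runs p s t s'" "t \<le> T1" "runs_within q s' T2 Q"
    using assms(1) unfolding runs_within_def by blast
  then obtain t' s'' where "runs q s' t' s''" "t' \<le> T2" "Q s''"
    unfolding runs_within_def by blast
  with 1 show ?thesis
    unfolding runs_within_def using assms(2) by (intro exI[of _ "t + t'"] exI[of _ s'']) (auto intro: runs_Seq)
qed

lemma runs_within_Cond:
  assumes "eval_test b s \<Longrightarrow> runs_within p s T Q" "\<not> eval_test b s \<Longrightarrow> runs_within q s T Q"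
  shows "runs_within (Cond b p q) s (Suc T) Q"
proof (cases "eval_test b s")
  case True
  with assms(1) show ?thesis unfolding runs_within_def by (meson Suc_le_mono runs_Cond_True)
next
  case False
  with assms(2) show ?thesis unfolding runs_within_def by (meson Suc_le_mono runs_Cond_False)
qed

text \<open>The invariant carries the number \<open>w\<close> of rounds done, and
  \<open>L - w\<close> decreases. A round costs its body and one test; the final \<open>+ 1\<close>
  is the failing test.\<close>

lemma runs_within_While:
  assumes "I w s"
    and "\<And>w s. I w s \<Longrightarrow> eval_test b s \<Longrightarrow> w < L \<and> runs_within p s B (I (Suc w))"
  shows "runs_within (While b p) s ((L - w) * (B + 1) + 1) (\<lambda>s'. \<exists>w'. I w' s' \<and> \<not> eval_test b s')"
  using assms(1)
proof (induction "L - w" arbitrary: w s rule: less_induct)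
  case less
  show ?case
  proof (cases "eval_test b s")
    case False
    then show ?thesis
      unfolding runs_within_def using less.prems by (meson le_add2 runs_While_False)
  next
    case True
    with less.prems assms(2) have w: "w < L" and b: "runs_within p s B (I (Suc w))" by blast+
    from b obtain t s' where 1: "runs p s t s'" "t \<le> B" "I (Suc w) s'" unfolding runs_within_def by blast
    from w have "L - Suc w < L - w" by simp
    from less.hyps[OF this 1(3)] obtain t' s'' where 2: "runs (While b p) s' t' s''"
      "t' \<le> (L - Suc w) * (B + 1) + 1" "\<exists>w'. I w' s'' \<and> \<not> eval_test b s''"
      unfolding runs_within_def by blast
    have "L - w = Suc (L - Suc w)" using w by simp
    then have "Suc (t + t') \<le> (L - w) * (B + 1) + 1" using 1(2) 2(2) by simp
    then show ?thesis
      unfolding runs_within_def using runs_While_True[OF True 1(1) 2(1)] 2(3) by blast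
  qed
qed

lemma set_reg_simps [simp]:
  "nreg (set_nreg x v s) = (nreg s)(x := v)" "rreg (set_nreg x v s) = rreg s"
  "narr (set_nreg x v s) = narr s" "rarr (set_nreg x v s) = rarr s"
  "rreg (set_rreg x r s) = (rreg s)(x := r)" "nreg (set_rreg x r s) = nreg s"
  "narr (set_rreg x r s) = narr s" "rarr (set_rreg x r s) = rarr s"
  "narr (set_narr a i v s) = (narr s)(a := (narr s a)(i := v))" "nreg (set_narr a i v s) = nreg s"
  "rreg (set_narr a i v s) = rreg s" "rarr (set_narr a i v s) = rarr s"
  by (simp_all add: set_nreg_def set_rreg_def set_narr_def)

text \<open>Frame condition for the distance queries: they write registers only, so the distance
  matrix and all point lists survive them.\<close>

definition agree :: "nat set \<Rightarrow> nat set \<Rightarrow> store \<Rightarrow> store \<Rightarrow> bool" where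
  "agree X Y s s' \<longleftrightarrow> (\<forall>x. x \<notin> X \<longrightarrow> nreg s' x = nreg s x) \<and> (\<forall>y. y \<notin> Y \<longrightarrow> rreg s' y = rreg s y) \<and>
     narr s' = narr s \<and> rarr s' = rarr s"

section \<open>The program\<close>

text \<open>
  Natural registers: 0 \<open>n\<close>, 1 \<open>min k n\<close>, 3 current point \<open>u\<close>, 4 \<open>u * n\<close>, 5 loop index, 6 scratch,
  7 farthest point, 8 size of the net, 9 carry, 10 the constant 1, 11 digit.
  Real registers: 0 \<open>\<epsilon>\<close>, 1 distance of \<open>u\<close> to the nearest center, 2 scratch, 3 covering radius,
  4 stopping threshold, 5 cost of the best solution so far.
  Natural arrays: 0 best solution so far, 1 net, 2 current candidate, 3 its indices into the net.
  Lacking a move instruction, a register is copied by clearing the target and adding.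
\<close>

definition nearest :: "nat \<Rightarrow> nat \<Rightarrow> prog" where
  "nearest a r =
     Seq (block [NConst 5 0, NLoad 6 a 5, NAdd 6 4 6, RLoad 1 0 6])
       (While (NLess 5 r)
         (Seq (block [NLoad 6 a 5, NAdd 6 4 6, RLoad 2 0 6])
         (Seq (Cond (RLess 2 1) (block [RLoad 1 0 6]) (block []))
           (block [NConst 6 1, NAdd 5 5 6]))))"

text \<open>The row offset \<open>u * n\<close> is maintained by repeated addition, since naturals
  cannot be multiplied. Radius 0 at point 0 is a valid start because distances are
  nonnegative.\<close>

definition farthest :: "nat \<Rightarrow> nat \<Rightarrow> prog" where
  "farthest a r =
     Seq (block [NConst 3 0, NConst 4 0, NConst 7 0, RConst 3 0])
       (While (NLess 3 0)
         (Seq (nearest a r)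
         (Seq (Cond (RLe 3 1) (block [RConst 3 0, RAdd 3 3 1, NConst 7 0, NAdd 7 7 3]) (block []))
           (block [NAdd 4 4 0, NConst 6 1, NAdd 3 3 6]))))"

definition add_farthest :: prog where
  "add_farthest = Seq (block [NStore 1 8 7, NConst 6 1, NAdd 8 8 6]) (farthest 1 8)"

text \<open>Registers 7 and 8 start at 0, so point 0 is added first without a special case. The
  threshold is computed once, from the radius at \<open>min k n\<close> points.\<close>

definition traversal :: prog where
  "traversal =
     Seq (While (NLess 8 1) add_farthest)
       (Seq (block [RConst 4 2, RDiv 4 3 4, RMul 4 0 4]) (While (RLess 4 3) add_farthest))"

definition copy :: prog where
  "copy = Seq (block [NConst 5 0])
     (While (NLess 5 1) (block [NLoad 6 2 5, NStore 0 5 6, NConst 6 1, NAdd 5 5 6]))"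

text \<open>Adding 1 is modelled by an initial carry of 1. A carry that survives the last digit
  signals that all tuples have been visited, and ends the enumeration loop.\<close>

definition successor :: prog where
  "successor = Seq (block [NConst 9 1, NConst 5 0])
     (While (NLess 5 1)
       (Seq (block [NLoad 11 3 5, NAdd 11 11 9, NConst 9 0])
       (Seq (Cond (NLe 8 11) (block [NConst 11 0, NConst 9 1]) (block []))
         (block [NStore 3 5 11, NLoad 6 1 11, NStore 2 5 6, NConst 6 1, NAdd 5 5 6]))))"

definition enumeration :: prog where
  "enumeration =
     Seq (farthest 0 1)
     (Seq (block [RConst 5 0, RAdd 5 5 3, NConst 9 0, NConst 10 1])
       (While (NLess 9 10)
         (Seq (farthest 2 1)
         (Seq (Cond (RLess 3 5) (Seq (block [RConst 5 0, RAdd 5 5 3]) copy) (block []))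
           successor))))"

text \<open>The last block replaces \<open>n\<close> in register 0 by the length of the list.
  Entries may repeat, which is harmless because the output is read as a set.\<close>

definition kcenter_prog :: prog where
  "kcenter_prog =
     Seq (Cond (NLess 0 1) (block [NConst 1 0, NAdd 1 1 0]) (block []))
     (Seq traversal (Seq enumeration (block [NConst 0 0, NAdd 0 0 1])))"

section \<open>Distance queries\<close>

definition distance_matrix :: "nat \<Rightarrow> (nat \<Rightarrow> nat \<Rightarrow> real) \<Rightarrow> store \<Rightarrow> bool" where
  "distance_matrix n \<rho> s \<longleftrightarrow> (\<forall>u<n. \<forall>v<n. rarr s 0 (u * n + v) = \<rho> u v)"

text \<open>This pins down \<open>r\<close> as the covering radius of the first \<open>q\<close>
  entries of \<open>A\<close>, attained at \<open>f\<close>, in a form free of \<open>Max\<close>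
  and \<open>Min\<close> that suits loop invariants.\<close>

definition farthest_from ::
    "nat \<Rightarrow> (nat \<Rightarrow> nat \<Rightarrow> real) \<Rightarrow> (nat \<Rightarrow> nat) \<Rightarrow> nat \<Rightarrow> nat \<Rightarrow> real \<Rightarrow> bool" where
  "farthest_from n \<rho> A q f r \<longleftrightarrow>
     f < n \<and> (\<forall>u<n. \<exists>j<q. \<rho> u (A j) \<le> r) \<and> (\<forall>j<q. r \<le> \<rho> f (A j))"

text \<open>Register 1 always holds a distance that occurs and is minimal among the entries scanned.
  Restricting \<open>r\<close> to the two length registers in use keeps it apart from the scratch
  registers.\<close>

lemma runs_within_nearest:
  assumes r: "r \<in> {1, 8}" "nreg s r = q" "q \<ge> 1" and u: "nreg s 4 = u * n" "u < n"
    and A: "\<forall>i<q. narr s a i < n" and m: "distance_matrix n \<rho> s"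
  shows "runs_within (nearest a r) s (11 * q + 6) (\<lambda>s'. agree {5, 6} {1, 2} s s' \<and>
    (\<exists>j<q. rreg s' 1 = \<rho> u (narr s a j)) \<and> (\<forall>j<q. rreg s' 1 \<le> \<rho> u (narr s a j)))"
proof -
  define I where "I i s' \<longleftrightarrow> agree {5, 6} {1, 2} s s' \<and> nreg s' 5 = i \<and> i \<le> q \<and>
    (\<exists>j<q. rreg s' 1 = \<rho> u (narr s a j)) \<and> (\<forall>j<i. rreg s' 1 \<le> \<rho> u (narr s a j))" for i s'
  have D: "rarr s 0 (u * n + narr s a i) = \<rho> u (narr s a i)" if "i < q" for i
    using m u A that unfolding distance_matrix_def by blast
  show ?thesis
    unfolding nearest_def
  proof (rule runs_within_Seq[OF runs_within_block[where T = 5]])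
    show "11 * q + 6 \<ge> 5 + ((q - 0) * (10 + 1) + 1)" by simp
    let ?s = "fold exec_instr [NConst 5 0, NLoad 6 a 5, NAdd 6 4 6, RLoad 1 0 6] s"
    have "I 0 ?s" using r u D[of 0] by (auto simp: I_def agree_def intro!: exI[of _ 0])
    then have "runs_within (While (NLess 5 r)
         (Seq (block [NLoad 6 a 5, NAdd 6 4 6, RLoad 2 0 6])
         (Seq (Cond (RLess 2 1) (block [RLoad 1 0 6]) (block []))
           (block [NConst 6 1, NAdd 5 5 6])))) ?s
        ((q - 0) * (10 + 1) + 1) (\<lambda>s'. \<exists>w'. I w' s' \<and> \<not> eval_test (NLess 5 r) s')"
    proof (rule runs_within_While)
      fix i s' assume I: "I i s'" and "eval_test (NLess 5 r) s'"
      then have i: "i < q" using r by (auto simp: I_def agree_def)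
      have "runs_within (Seq (block [NLoad 6 a 5, NAdd 6 4 6, RLoad 2 0 6])
         (Seq (Cond (RLess 2 1) (block [RLoad 1 0 6]) (block []))
           (block [NConst 6 1, NAdd 5 5 6]))) s' 10 (I (Suc i))"
        apply (rule runs_within_Seq[where ?T1.0 = 4 and ?T2.0 = 6])
         apply (rule runs_within_block)
          apply (rule runs_within_Seq[where ?T1.0 = "Suc 2" and ?T2.0 = 3])
           apply (rule runs_within_Cond; rule runs_within_block; (rule runs_within_block)?)
        using I i D[OF i] u
        by (auto simp: I_def agree_def less_Suc_eq)
      with i show "i < q \<and> runs_within (Seq (block [NLoad 6 a 5, NAdd 6 4 6, RLoad 2 0 6])
         (Seq (Cond (RLess 2 1) (block [RLoad 1 0 6]) (block []))
           (block [NConst 6 1, NAdd 5 5 6]))) s' 10 (I (Suc i))" ..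
    qed
    then show "runs_within (While (NLess 5 r)
         (Seq (block [NLoad 6 a 5, NAdd 6 4 6, RLoad 2 0 6])
         (Seq (Cond (RLess 2 1) (block [RLoad 1 0 6]) (block []))
           (block [NConst 6 1, NAdd 5 5 6])))) ?s
        ((q - 0) * (10 + 1) + 1) (\<lambda>s'. agree {5, 6} {1, 2} s s' \<and>
    (\<exists>j<q. rreg s' 1 = \<rho> u (narr s a j)) \<and> (\<forall>j<q. rreg s' 1 \<le> \<rho> u (narr s a j)))"
    proof (rule runs_within_mono)
      fix s' assume "\<exists>w'. I w' s' \<and> \<not> eval_test (NLess 5 r) s'"
      then obtain i where "I i s'" "\<not> eval_test (NLess 5 r) s'" by blast
      moreover from this have "i = q" using r by (auto simp: I_def agree_def)
      ultimately show "agree {5, 6} {1, 2} s s' \<and>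
          (\<exists>j<q. rreg s' 1 = \<rho> u (narr s a j)) \<and> (\<forall>j<q. rreg s' 1 \<le> \<rho> u (narr s a j))"
        by (simp add: I_def)
    qed simp
  qed simp
qed

lemma runs_within_farthest:
  assumes r: "r \<in> {1, 8}" "nreg s r = q" "q \<ge> 1" and n: "nreg s 0 = n" "n \<ge> 1"
    and A: "\<forall>i<q. narr s a i < n" and m: "distance_matrix n \<rho> s"
    and nonneg: "\<And>u v. u < n \<Longrightarrow> v < n \<Longrightarrow> 0 \<le> \<rho> u v"
  shows "runs_within (farthest a r) s (34 * n * q) (\<lambda>s'. agree {3, 4, 5, 6, 7} {1, 2, 3} s s' \<and>
    farthest_from n \<rho> (narr s a) q (nreg s' 7) (rreg s' 3))"
proof -
  define I where "I u s' \<longleftrightarrow> agree {3, 4, 5, 6, 7} {1, 2, 3} s s' \<and> nreg s' 3 = u \<and> u \<le> n \<and>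
    nreg s' 4 = u * n \<and> nreg s' 7 < n \<and>
    (\<forall>v<u. \<exists>j<q. \<rho> v (narr s a j) \<le> rreg s' 3) \<and>
    (\<forall>j<q. rreg s' 3 \<le> \<rho> (nreg s' 7) (narr s a j))" for u s'
  let ?body = "Seq (nearest a r)
         (Seq (Cond (RLe 3 1) (block [RConst 3 0, RAdd 3 3 1, NConst 7 0, NAdd 7 7 3]) (block []))
           (block [NAdd 4 4 0, NConst 6 1, NAdd 3 3 6]))"
  let ?s = "fold exec_instr [NConst 3 0, NConst 4 0, NConst 7 0, RConst 3 0] s"
  have step: "u < n \<and> runs_within ?body s' (11 * q + 16) (I (Suc u))"
    if I: "I u s'" and t: "eval_test (NLess 3 0) s'" for u s'
  proof -
    have u: "u < n" using I t n by (auto simp: I_def agree_def)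
    have "runs_within (nearest a r) s' (11 * q + 6) (\<lambda>s''. agree {5, 6} {1, 2} s' s'' \<and>
      (\<exists>j<q. rreg s'' 1 = \<rho> u (narr s' a j)) \<and> (\<forall>j<q. rreg s'' 1 \<le> \<rho> u (narr s' a j)))"
      by (rule runs_within_nearest[where n = n]) (use I r A m u in \<open>auto simp: I_def agree_def distance_matrix_def\<close>)
    then have "runs_within ?body s' (11 * q + 16) (I (Suc u))"
    proof (intro runs_within_Seq[where ?T1.0 = "11 * q + 6" and ?T2.0 = 10], elim runs_within_mono)
      fix s'' assume s'': "agree {5, 6} {1, 2} s' s'' \<and> (\<exists>j<q. rreg s'' 1 = \<rho> u (narr s' a j)) \<and>
        (\<forall>j<q. rreg s'' 1 \<le> \<rho> u (narr s' a j))"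
      then have e: "narr s' a = narr s a" "nreg s'' 3 = u" "nreg s'' 4 = u * n" "nreg s'' 0 = n"
        "nreg s'' 7 = nreg s' 7" "rreg s'' 3 = rreg s' 3"
        "agree {3, 4, 5, 6, 7} {1, 2, 3} s s''"
        using I n by (auto simp: I_def agree_def)
      show "runs_within (Seq (Cond (RLe 3 1) (block [RConst 3 0, RAdd 3 3 1, NConst 7 0, NAdd 7 7 3])
           (block [])) (block [NAdd 4 4 0, NConst 6 1, NAdd 3 3 6])) s'' 10 (I (Suc u))"
        apply (rule runs_within_Seq[where ?T1.0 = "Suc 5" and ?T2.0 = 4])
         apply (rule runs_within_Cond; rule runs_within_block; (rule runs_within_block)?)
        using I s'' u e
        by (auto simp: I_def agree_def less_Suc_eq) (meson order_trans)
    qed auto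
    with u show ?thesis by blast
  qed
  have "I 0 ?s" using n A nonneg by (auto simp: I_def agree_def)
  from runs_within_While[of I, OF this step] have
    "runs_within (While (NLess 3 0) ?body) ?s ((n - 0) * (11 * q + 16 + 1) + 1)
      (\<lambda>s'. \<exists>w'. I w' s' \<and> \<not> eval_test (NLess 3 0) s')" by blast
  then have loop: "runs_within (While (NLess 3 0) ?body) ?s ((n - 0) * (11 * q + 16 + 1) + 1)
     (\<lambda>s'. agree {3, 4, 5, 6, 7} {1, 2, 3} s s' \<and>
    farthest_from n \<rho> (narr s a) q (nreg s' 7) (rreg s' 3))"
  proof (rule runs_within_mono)
    fix s' assume "\<exists>w'. I w' s' \<and> \<not> eval_test (NLess 3 0) s'"
    then obtain u where "I u s'" "\<not> eval_test (NLess 3 0) s'" by blast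
    moreover from this have "u = n" using n by (auto simp: I_def agree_def)
    ultimately show "agree {3, 4, 5, 6, 7} {1, 2, 3} s s' \<and>
      farthest_from n \<rho> (narr s a) q (nreg s' 7) (rreg s' 3)"
      by (simp add: I_def farthest_from_def)
  qed simp
  \<comment> \<open>The lower-order terms are absorbed into \<open>n * q\<close>, and 34 = 11 + 17 +
    6.\<close>
  have "n \<le> n * q" "1 \<le> n * q" using r(3) n(2) by simp_all
  then have "11 * (n * q) + 17 * n + 6 \<le> 34 * (n * q)" by linarith
  then have "5 + ((n - 0) * (11 * q + 16 + 1) + 1) \<le> 34 * n * q"
    by (simp add: algebra_simps)
  with loop show ?thesis
    unfolding farthest_def by (intro runs_within_Seq[OF runs_within_block[where T = 5]]) auto
qed

section \<open>Costs, packings and nets\<close>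

definition digit :: "nat \<Rightarrow> nat \<Rightarrow> nat \<Rightarrow> nat" where
  "digit M w i = w div M ^ i mod M"

lemma digit_less: "M > 0 \<Longrightarrow> digit M w i < M"
  by (simp add: digit_def)

text \<open>Induction on \<open>K\<close>: adding \<open>f K * M ^ K\<close> sets the top digit. For
  \<open>i < K\<close> this summand is a multiple of \<open>M * M ^ i\<close>, so digit
  \<open>i\<close> does not change.\<close>

lemma digits_surj:
  assumes "\<And>i. i < K \<Longrightarrow> f i < M"
  shows "\<exists>w < M ^ K. \<forall>i<K. digit M w i = f i"
  using assms
proof (induction K)
  case (Suc K)
  then obtain w where w: "w < M ^ K" "\<forall>i<K. digit M w i = f i" by auto
  have fK: "f K < M" using Suc.prems by simp
  then have M: "M > 0" by simp
  have "digit M (w + f K * M ^ K) i = f i" if "i < Suc K" for i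
  proof (cases "i = K")
    case True
    then show ?thesis using w(1) fK M by (simp add: digit_def)
  next
    case False
    with that have i: "i < K" by simp
    then have "M ^ K = M ^ (Suc (K - Suc i) + i)" by simp
    then have "M ^ K = M * M ^ (K - Suc i) * M ^ i" by (simp only: power_add power_Suc)
    then have "w + f K * M ^ K = w + M ^ i * (M * (f K * M ^ (K - Suc i)))" by simp
    then have "(w + f K * M ^ K) div M ^ i = (w + M ^ i * (M * (f K * M ^ (K - Suc i)))) div M ^ i"
      by (rule arg_cong)
    also have "\<dots> = w div M ^ i + M * (f K * M ^ (K - Suc i))"
      using M by (subst div_mult_self2) auto
    finally have "(w + f K * M ^ K) div M ^ i = w div M ^ i + M * (f K * M ^ (K - Suc i))" .
    then show ?thesis using w(2) i by (simp add: digit_def)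
  qed
  moreover have "w + f K * M ^ K < M ^ Suc K"
  proof -
    have "w + f K * M ^ K < (1 + f K) * M ^ K" using w(1) by simp
    also have "\<dots> \<le> M * M ^ K" using fK by (intro mult_right_mono) auto
    finally show ?thesis by simp
  qed
  ultimately show ?case by blast
qed auto

section \<open>Feasible sets and the optimal cost\<close>

lemma kcenter_feasible_min:
  "kcenter_feasible {..<n} (min k n) C \<longleftrightarrow> kcenter_feasible {..<n} k C"
  unfolding kcenter_feasible_def using card_mono[of "{..<n}" C] by auto

lemma finite_feasible: "finite V \<Longrightarrow> finite {C. kcenter_feasible V k C}"
  by (rule finite_subset[of _ "Pow V"]) (auto simp: kcenter_feasible_def)

lemma kcenter_cost_le_iff:
  assumes "finite V" "V \<noteq> {}" "finite C" "C \<noteq> {}"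
  shows "kcenter_cost V \<rho> C \<le> r \<longleftrightarrow> (\<forall>u\<in>V. \<exists>v\<in>C. \<rho> u v \<le> r)"
  unfolding kcenter_cost_def using assms by (simp add: Min_le_iff)

lemma kcenter_opt_attained:
  assumes "finite V" "V \<noteq> {}" "k \<ge> 1"
  obtains C where "kcenter_feasible V k C" "kcenter_cost V \<rho> C = kcenter_opt V \<rho> k"
proof -
  obtain x where "x \<in> V" using assms(2) by blast
  then have "kcenter_feasible V k {x}" using assms(3) by (simp add: kcenter_feasible_def)
  then have "kcenter_opt V \<rho> k \<in> kcenter_cost V \<rho> ` {C. kcenter_feasible V k C}"
    unfolding kcenter_opt_def using assms(1) by (intro Min_in) (auto simp: finite_feasible)
  with that show thesis by auto
qed

section \<open>Covering and packing in doubling metrics, and the quality of nets\<close>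

context Metric_space
begin

text \<open>Each halving replaces every ball of the cover by at most \<open>2 powr \<delta>\<close>
  balls of half the radius, so the factors multiply.\<close>

lemma doubling_bound_iterate:
  assumes "doubling_bound M d \<delta>" "r > 0" "x \<in> M"
  shows "\<exists>C. finite C \<and> C \<subseteq> M \<and> real (card C) \<le> (2 powr \<delta>) ^ j \<and>
    mcball x r \<subseteq> (\<Union>c\<in>C. mcball c (r / 2 ^ j))"
proof (induction j)
  case 0
  then show ?case using assms(3) by (intro exI[of _ "{x}"]) auto
next
  case (Suc j)
  then obtain C where C: "finite C" "C \<subseteq> M" "real (card C) \<le> (2 powr \<delta>) ^ j"
    "mcball x r \<subseteq> (\<Union>c\<in>C. mcball c (r / 2 ^ j))" by blast
  have pos: "r / 2 ^ Suc j > 0" using assms(2) by simp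
  have "\<forall>c\<in>C. \<exists>D. finite D \<and> D \<subseteq> M \<and> real (card D) \<le> 2 powr \<delta> \<and>
        mcball c (2 * (r / 2 ^ Suc j)) \<subseteq> (\<Union>e\<in>D. mcball e (r / 2 ^ Suc j))"
  proof
    fix c assume "c \<in> C"
    then have "c \<in> M" using C(2) by blast
    from assms(1)[unfolded doubling_bound_def, rule_format, OF pos this]
    show "\<exists>D. finite D \<and> D \<subseteq> M \<and> real (card D) \<le> 2 powr \<delta> \<and>
        mcball c (2 * (r / 2 ^ Suc j)) \<subseteq> (\<Union>e\<in>D. mcball e (r / 2 ^ Suc j))" .
  qed
  from bchoice[OF this] obtain D where
    D: "\<forall>c\<in>C. finite (D c) \<and> D c \<subseteq> M \<and> real (card (D c)) \<le> 2 powr \<delta> \<and>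
        mcball c (2 * (r / 2 ^ Suc j)) \<subseteq> (\<Union>e\<in>D c. mcball e (r / 2 ^ Suc j))" ..
  have "real (card (\<Union>c\<in>C. D c)) \<le> real (\<Sum>c\<in>C. card (D c))"
    using C(1) by (intro of_nat_mono card_UN_le)
  also have "\<dots> = (\<Sum>c\<in>C. real (card (D c)))" by simp
  also have "\<dots> \<le> real (card C) * 2 powr \<delta>" using D by (intro sum_bounded_above) auto
  also have "\<dots> \<le> (2 powr \<delta>) ^ j * 2 powr \<delta>" using C(3) by (intro mult_right_mono) auto
  finally have card: "real (card (\<Union>c\<in>C. D c)) \<le> (2 powr \<delta>) ^ Suc j" by (simp add: mult.commute)
  have "mcball x r \<subseteq> (\<Union>e\<in>(\<Union>c\<in>C. D c). mcball e (r / 2 ^ Suc j))"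
  proof
    fix y assume "y \<in> mcball x r"
    then obtain c where c: "c \<in> C" "y \<in> mcball c (r / 2 ^ j)" using C(4) by blast
    then have "y \<in> mcball c (2 * (r / 2 ^ Suc j))" by simp
    with D c(1) obtain e where "e \<in> D c" "y \<in> mcball e (r / 2 ^ Suc j)" by blast
    with c(1) show "y \<in> (\<Union>e\<in>(\<Union>c\<in>C. D c). mcball e (r / 2 ^ Suc j))" by blast
  qed
  moreover have "finite (\<Union>c\<in>C. D c)" "(\<Union>c\<in>C. D c) \<subseteq> M" using C(1) D by blast+
  ultimately show ?case using card by blast
qed

text \<open>The balls of radius \<open>r\<close> around \<open>B\<close> are covered by balls of
  radius \<open>r / 2 ^ j\<close>. Two points in the same small ball are at distance at most
  \<open>t\<close>, so sending each point of \<open>P\<close> to the center of a small ball around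
  it is injective.\<close>

lemma packing_bound:
  assumes "doubling_bound M d \<delta>" "r > 0" and t: "2 * (r / 2 ^ j) \<le> t"
    and B: "finite B" "B \<subseteq> M" and P: "P \<subseteq> M"
    and cover: "\<And>x. x \<in> P \<Longrightarrow> \<exists>b\<in>B. d x b \<le> r"
    and sep: "\<And>x y. x \<in> P \<Longrightarrow> y \<in> P \<Longrightarrow> x \<noteq> y \<Longrightarrow> t < d x y"
  shows "real (card P) \<le> real (card B) * (2 powr \<delta>) ^ j"
proof -
  have "\<forall>b\<in>B. \<exists>C. finite C \<and> C \<subseteq> M \<and> real (card C) \<le> (2 powr \<delta>) ^ j \<and>
    mcball b r \<subseteq> (\<Union>c\<in>C. mcball c (r / 2 ^ j))"
    using doubling_bound_iterate[OF assms(1,2)] B by blast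
  from bchoice[OF this] obtain C where C: "\<forall>b\<in>B. finite (C b) \<and> C b \<subseteq> M \<and>
      real (card (C b)) \<le> (2 powr \<delta>) ^ j \<and> mcball b r \<subseteq> (\<Union>c\<in>C b. mcball c (r / 2 ^ j))" ..
  have "\<exists>c\<in>(\<Union>b\<in>B. C b). d c x \<le> r / 2 ^ j" if x: "x \<in> P" for x
  proof -
    obtain b where b: "b \<in> B" "d x b \<le> r" using cover[OF x] by blast
    then have "x \<in> mcball b r" using B P x commute[of x b] by (auto simp: in_mcball)
    with C b(1) obtain c where "c \<in> C b" "x \<in> mcball c (r / 2 ^ j)" by blast
    with b(1) show ?thesis by (auto simp: in_mcball)
  qed
  then obtain g where g: "\<And>x. x \<in> P \<Longrightarrow> g x \<in> (\<Union>b\<in>B. C b) \<and> d (g x) x \<le> r / 2 ^ j" by metis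
  have "inj_on g P"
  proof (rule inj_onI, rule ccontr)
    fix x y assume xy: "x \<in> P" "y \<in> P" "g x = g y" "x \<noteq> y"
    have "g x \<in> M" using g[OF xy(1)] C by blast
    then have "d x y \<le> d (g x) x + d (g x) y"
      using triangle[of x "g x" y] commute[of x "g x"] P xy by auto
    also have "\<dots> \<le> t" using g[OF xy(1)] g[OF xy(2)] xy(3) t by simp
    finally show False using sep[OF xy(1,2,4)] by simp
  qed
  moreover have "g ` P \<subseteq> (\<Union>b\<in>B. C b)" using g by blast
  moreover have "finite (\<Union>b\<in>B. C b)" using B C by blast
  ultimately have "card P \<le> card (\<Union>b\<in>B. C b)" by (rule card_inj_on_le)
  also have "\<dots> \<le> (\<Sum>b\<in>B. card (C b))" by (rule card_UN_le[OF B(1)])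
  finally have "real (card P) \<le> (\<Sum>b\<in>B. real (card (C b)))"
    by (metis of_nat_le_iff of_nat_sum)
  also have "\<dots> \<le> real (card B) * (2 powr \<delta>) ^ j" using C by (intro sum_bounded_above) auto
  finally show ?thesis .
qed

text \<open>A ball contains its center, so its cover has at least one member and
  \<open>1 \<le> 2 powr \<delta>\<close>. The sign makes the later bounds monotone in the
  exponents.\<close>

lemma doubling_bound_nonneg:
  assumes "doubling_bound M d \<delta>" "x \<in> M"
  shows "\<delta> \<ge> 0"
proof -
  obtain C where "finite C" "real (card C) \<le> 2 powr \<delta>" "mcball x (2 * 1) \<subseteq> (\<Union>c\<in>C. mcball c 1)"
    using assms(1)[unfolded doubling_bound_def, rule_format, OF zero_less_one assms(2)] by blast
  moreover have "x \<in> mcball x (2 * 1)" using assms(2) by simp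
  ultimately have "C \<noteq> {}" "finite C" by blast+
  then have "card C \<ge> 1" by (simp add: Suc_leI card_gt_0_iff)
  with \<open>real (card C) \<le> 2 powr \<delta>\<close> have "1 \<le> 2 powr \<delta>" by linarith
  then show ?thesis using powr_less_one[of 2 \<delta>] by linarith
qed

text \<open>Any \<open>k\<close> centers serve two of the \<open>k + 1\<close> points from the same center.\<close>

lemma separated_le_twice_opt:
  assumes fin: "finite M" and k: "k \<ge> 1"
    and P: "\<And>i. i \<le> k \<Longrightarrow> P i \<in> M" and sep: "\<And>i j. i < j \<Longrightarrow> j \<le> k \<Longrightarrow> r \<le> d (P i) (P j)"
  shows "r \<le> 2 * kcenter_opt M d k"
proof -
  have ne: "M \<noteq> {}" using P[of 0] by auto
  obtain C where C: "kcenter_feasible M k C" "kcenter_cost M d C = kcenter_opt M d k"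
    using kcenter_opt_attained[OF fin ne k] .
  then have CM: "C \<subseteq> M" "C \<noteq> {}" "card C \<le> k" by (auto simp: kcenter_feasible_def)
  then have finC: "finite C" using fin finite_subset by blast
  have "\<forall>u\<in>M. \<exists>v\<in>C. d u v \<le> kcenter_opt M d k"
    using kcenter_cost_le_iff[OF fin ne finC CM(2), of d "kcenter_opt M d k"] C(2) by simp
  then have "\<forall>i\<in>{..k}. \<exists>v. v \<in> C \<and> d (P i) v \<le> kcenter_opt M d k"
    using P by (metis atMost_iff)
  from bchoice[OF this] obtain g where
    g: "\<And>i. i \<le> k \<Longrightarrow> g i \<in> C \<and> d (P i) (g i) \<le> kcenter_opt M d k" by auto
  have "\<not> inj_on g {..k}"
  proof
    assume "inj_on g {..k}"
    then have "card {..k} \<le> card C" using g finC by (intro card_inj_on_le[of g]) auto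
    with CM(3) show False by simp
  qed
  then obtain i j where ij: "i \<le> k" "j \<le> k" "g i = g j" "i < j"
    unfolding inj_on_def by (metis atMost_iff nat_neq_iff)
  have "r \<le> d (P i) (P j)" using sep ij by blast
  also have "\<dots> \<le> d (P i) (g i) + d (P j) (g i)"
    using triangle[of "P i" "g i" "P j"] commute[of "g i" "P j"] P g CM(1) ij by auto
  also have "\<dots> \<le> 2 * kcenter_opt M d k" using g[OF ij(1)] g[OF ij(2)] ij(3) by simp
  finally show ?thesis .
qed

text \<open>Optimal centers are moved to net points at distance at most \<open>t\<close>, and the
  triangle inequality adds \<open>t\<close> to every service distance. The resulting tuple of net
  indices is the digit sequence of some \<open>w\<close>.\<close>

lemma net_contains_approx:
  assumes fin: "finite M" and k: "k \<ge> 1" and N: "\<And>i. i < m \<Longrightarrow> N i \<in> M"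
    and cover: "\<And>u. u \<in> M \<Longrightarrow> \<exists>i<m. d u (N i) \<le> t" and ne: "M \<noteq> {}"
  shows "\<exists>w < m ^ k. kcenter_cost M d ((\<lambda>i. N (digit m w i)) ` {..<k}) \<le> kcenter_opt M d k + t"
proof -
  obtain C where C: "kcenter_feasible M k C" "kcenter_cost M d C = kcenter_opt M d k"
    using kcenter_opt_attained[OF fin ne k] .
  then have CM: "C \<subseteq> M" "C \<noteq> {}" "card C \<le> k" by (auto simp: kcenter_feasible_def)
  then have finC: "finite C" using fin finite_subset by blast
  have opt: "\<forall>u\<in>M. \<exists>v\<in>C. d u v \<le> kcenter_opt M d k"
    using kcenter_cost_le_iff[OF fin ne finC CM(2), of d "kcenter_opt M d k"] C(2) by simp
  obtain h where h: "bij_betw h {..<card C} C"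
    using ex_bij_betw_nat_finite[OF finC] by (auto simp: atLeast0LessThan)
  \<comment> \<open>Tuples have exactly \<open>k\<close> entries, so an optimal set with fewer
    centers is padded with copies of \<open>h 0\<close>.\<close>
  define c where "c i = (if i < card C then h i else h 0)" for i
  have cC: "c i \<in> C" for i
  proof -
    have "card C > 0" using CM(2) finC by (simp add: card_gt_0_iff)
    then show ?thesis using bij_betw_apply[OF h] by (simp add: c_def)
  qed
  have cs: "\<exists>i<k. c i = v" if v: "v \<in> C" for v
  proof -
    have "v \<in> h ` {..<card C}" using h v by (simp add: bij_betw_def)
    then obtain i where "i < card C" "h i = v" by auto
    with CM(3) show ?thesis by (intro exI[of _ i]) (simp add: c_def)
  qed
  have "\<exists>j<m. d (c i) (N j) \<le> t" for i using cover cC CM(1) by blast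
  then obtain f where f: "\<And>i. f i < m \<and> d (c i) (N (f i)) \<le> t" by metis
  obtain w where w: "w < m ^ k" "\<forall>i<k. digit m w i = f i" using digits_surj[of k f m] f by blast
  have "\<exists>v \<in> (\<lambda>i. N (digit m w i)) ` {..<k}. d u v \<le> kcenter_opt M d k + t" if u: "u \<in> M" for u
  proof -
    obtain v where v: "v \<in> C" "d u v \<le> kcenter_opt M d k" using opt u by blast
    obtain i where i: "i < k" "c i = v" using cs[OF v(1)] by blast
    have "d u (N (f i)) \<le> d u v + d v (N (f i))"
      using triangle[of u v "N (f i)"] u v(1) CM(1) N f by blast
    also have "\<dots> \<le> kcenter_opt M d k + t" using v(2) f[of i] i(2) by simp
    finally show ?thesis using i(1) w(2) by (auto intro!: bexI[of _ i])
  qed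
  then have "kcenter_cost M d ((\<lambda>i. N (digit m w i)) ` {..<k}) \<le> kcenter_opt M d k + t"
    using k by (subst kcenter_cost_le_iff[OF fin ne]) (auto simp: lessThan_empty_iff)
  with w(1) show ?thesis by blast
qed

end

text \<open>With \<open>e = min \<epsilon> (1 / 2)\<close>, rounding up \<open>log 2 (4 / e)\<close>
  gives \<open>4 / e \<le> 2 ^ j \<le> 8 / e\<close>. Since \<open>e \<le> 1 / 2\<close>, the factor
  8 is at most \<open>1 / e ^ 3\<close>, so \<open>2 ^ j\<close> is at most
  \<open>1 / e ^ 4\<close>: this is the source of the exponent 4 and the use of the cap.\<close>

lemma powr_halving_bound:
  fixes \<epsilon> \<delta> :: real
  assumes "\<epsilon> > 0" "\<delta> \<ge> 0"
  obtains j where "4 \<le> 2 ^ j * \<epsilon>" "(2 powr \<delta>) ^ j \<le> (min \<epsilon> (1 / 2)) powr (- (4 * \<delta>))"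
proof -
  define e where "e = min \<epsilon> (1 / 2)"
  have e: "0 < e" "e \<le> 1 / 2" "e \<le> \<epsilon>" using assms by (auto simp: e_def)
  define j where "j = nat \<lceil>log 2 (4 / e)\<rceil>"
  \<comment> \<open>Nonnegativity ensures that \<open>nat\<close> does not truncate the
    ceiling.\<close>
  have l0: "log 2 (4 / e) \<ge> 0" using e by (simp add: field_simps)
  have j1: "log 2 (4 / e) \<le> real j" and j2: "real j \<le> log 2 (4 / e) + 1"
    using l0 unfolding j_def by linarith+
  have "4 / e = 2 powr (log 2 (4 / e))" using e by simp
  also have "\<dots> \<le> 2 powr (real j)" using j1 by simp
  finally have "4 \<le> 2 ^ j * e" using e by (simp add: powr_realpow field_simps)
  also have "\<dots> \<le> 2 ^ j * \<epsilon>" using e by simp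
  finally have 1: "4 \<le> 2 ^ j * \<epsilon>" .
  have "log 2 (4 / e) + 1 = log 2 (8 / e)"
    using e log_mult[of 2 2 "4 / e"] by simp
  also have "\<dots> \<le> log 2 (e powr (- 4))"
  proof -
    have "8 * e ^ 3 \<le> 8 * (1 / 2) ^ 3" using e by (intro mult_left_mono power_mono) auto
    then have "8 * e ^ 3 * e \<le> 1 * e" using e by (intro mult_right_mono) (simp_all add: power3_eq_cube)
    moreover have "e ^ 4 = e ^ 3 * e" by (simp add: eval_nat_numeral)
    ultimately have "8 * e ^ 4 \<le> e" by simp
    then have "8 / e \<le> 1 / e ^ 4" using e by (simp add: divide_simps)
    also have "\<dots> = e powr (- real 4)" using e by (simp add: powr_minus_divide powr_realpow del: of_nat_numeral)
    finally have "8 / e \<le> e powr (- 4)" by simp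
    then show ?thesis using e by (subst log_le_cancel_iff) auto
  qed
  finally have j3: "real j \<le> log 2 (e powr (- 4))" using j2 by linarith
  have "(2 powr \<delta>) ^ j = (2 powr real j) powr \<delta>"
    by (simp add: powr_powr mult.commute flip: powr_realpow)
  also have "\<dots> \<le> (2 powr (log 2 (e powr (- 4)))) powr \<delta>"
    using j3 assms(2) by (intro powr_mono2) auto
  also have "\<dots> = e powr (- (4 * \<delta>))" using e by (simp add: powr_powr)
  finally show thesis using that 1 unfolding e_def by blast
qed

section \<open>Enumeration of candidates\<close>

lemma runs_within_copy:
  assumes "nreg s 1 = q"
  shows "runs_within copy s (6 * q + 3) (\<lambda>s'. (\<forall>x. x \<notin> {5, 6} \<longrightarrow> nreg s' x = nreg s x) \<and>
    rreg s' = rreg s \<and> rarr s' = rarr s \<and> (\<forall>a. a \<noteq> 0 \<longrightarrow> narr s' a = narr s a) \<and>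
    (\<forall>i<q. narr s' 0 i = narr s 2 i))" (is "runs_within _ _ _ ?Q")
proof -
  define I where "I i s' \<longleftrightarrow> (\<forall>x. x \<notin> {5, 6} \<longrightarrow> nreg s' x = nreg s x) \<and>
    rreg s' = rreg s \<and> rarr s' = rarr s \<and> (\<forall>a. a \<noteq> 0 \<longrightarrow> narr s' a = narr s a) \<and>
    nreg s' 5 = i \<and> i \<le> q \<and> (\<forall>j<i. narr s' 0 j = narr s 2 j)" for i and s' :: store
  let ?body = "block [NLoad 6 2 5, NStore 0 5 6, NConst 6 1, NAdd 5 5 6]"
  let ?s = "fold exec_instr [NConst 5 0] s"
  have "runs_within (While (NLess 5 1) ?body) ?s ((q - 0) * (5 + 1) + 1)
      (\<lambda>s'. \<exists>i. I i s' \<and> \<not> eval_test (NLess 5 1) s')"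
  proof (rule runs_within_While)
    show "I 0 ?s" by (simp add: I_def)
    fix i s' assume I: "I i s'" and "eval_test (NLess 5 1) s'"
    then have i: "i < q" using assms by (simp add: I_def)
    moreover have "runs_within ?body s' 5 (I (Suc i))"
      by (rule runs_within_block) (use I i in \<open>auto simp: I_def less_Suc_eq\<close>)
    ultimately show "i < q \<and> runs_within ?body s' 5 (I (Suc i))" ..
  qed
  then have "runs_within (While (NLess 5 1) ?body) ?s ((q - 0) * (5 + 1) + 1) ?Q"
  proof (rule runs_within_mono)
    fix s' assume "\<exists>i. I i s' \<and> \<not> eval_test (NLess 5 1) s'"
    then obtain i where I: "I i s'" "\<not> eval_test (NLess 5 1) s'" by blast
    then have "i = q" using assms by (simp add: I_def)
    with I show "?Q s'" by (simp add: I_def)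
  qed simp
  then show ?thesis
    unfolding copy_def by (intro runs_within_Seq[OF runs_within_block[where T = 2]]) auto
qed

text \<open>One position of the odometer. A digit is below \<open>m\<close> and the carry is at most
  1, so an overflowing sum equals \<open>m\<close> exactly, leaving digit 0 and carry 1.\<close>

lemma add_carry_div_mod:
  fixes q c m :: nat
  assumes "m \<ge> 1" "c \<le> 1"
  shows "m \<le> q mod m + c \<Longrightarrow> (q + c) mod m = 0 \<and> (q + c) div m = q div m + 1"
    and "\<not> m \<le> q mod m + c \<Longrightarrow> (q + c) mod m = q mod m + c \<and> (q + c) div m = q div m"
proof -
  have q: "q + c = m * (q div m) + (q mod m + c)" by simp
  assume "m \<le> q mod m + c"
  moreover have "q mod m < m" using assms by simp
  ultimately have "q mod m + c = m" using assms(2) by linarith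
  with q have "q + c = m * (q div m + 1)" by (metis distrib_left mult.right_neutral)
  with assms show "(q + c) mod m = 0 \<and> (q + c) div m = q div m + 1" by simp
next
  have q: "q + c = (q mod m + c) + m * (q div m)" by simp
  assume "\<not> m \<le> q mod m + c"
  then have "q mod m + c < m" by simp
  then have "(q mod m + c + m * (q div m)) mod m = q mod m + c"
    "(q mod m + c + m * (q div m)) div m = q div m"
    by (simp_all only: mod_mult_self2 mod_less div_mult_self2 div_less)
  then show "(q + c) mod m = q mod m + c \<and> (q + c) div m = q div m"
    by (simp only: q[symmetric])
qed

lemma runs_within_successor:
  assumes q: "nreg s 1 = q" and m: "nreg s 8 = m" "m \<ge> 1" and w: "w < m ^ q"
    and dig: "\<forall>i<q. narr s 3 i = digit m w i"
  shows "runs_within successor s (15 * q + 4) (\<lambda>s'. (\<forall>x. x \<notin> {5, 6, 9, 11} \<longrightarrow> nreg s' x = nreg s x) \<and>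
    rreg s' = rreg s \<and> rarr s' = rarr s \<and> (\<forall>a. a \<notin> {2, 3} \<longrightarrow> narr s' a = narr s a) \<and>
    nreg s' 9 = (if Suc w < m ^ q then 0 else 1) \<and>
    (\<forall>i<q. narr s' 3 i = digit m (Suc w) i \<and> narr s' 2 i = narr s 1 (digit m (Suc w) i)))"
    (is "runs_within _ _ _ ?Q")
proof -
  \<comment> \<open>The carry at position \<open>i\<close> is the difference of the quotients of
    \<open>Suc w\<close> and \<open>w\<close> by \<open>m ^ i\<close>. At \<open>i = q\<close> the
    quotient of \<open>w\<close> is 0, so the last carry is 1 exactly when \<open>Suc w\<close>
    reaches \<open>m ^ q\<close>.\<close>
  define I where "I i s' \<longleftrightarrow> (\<forall>x. x \<notin> {5, 6, 9, 11} \<longrightarrow> nreg s' x = nreg s x) \<and>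
    rreg s' = rreg s \<and> rarr s' = rarr s \<and> (\<forall>a. a \<notin> {2, 3} \<longrightarrow> narr s' a = narr s a) \<and>
    nreg s' 5 = i \<and> i \<le> q \<and> nreg s' 9 \<le> 1 \<and> Suc w div m ^ i = w div m ^ i + nreg s' 9 \<and>
    (\<forall>j\<ge>i. narr s' 3 j = narr s 3 j) \<and>
    (\<forall>j<i. narr s' 3 j = digit m (Suc w) j \<and> narr s' 2 j = narr s 1 (digit m (Suc w) j))" for i and s' :: store
  let ?body = "Seq (block [NLoad 11 3 5, NAdd 11 11 9, NConst 9 0])
       (Seq (Cond (NLe 8 11) (block [NConst 11 0, NConst 9 1]) (block []))
         (block [NStore 3 5 11, NLoad 6 1 11, NStore 2 5 6, NConst 6 1, NAdd 5 5 6]))"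
  let ?s = "fold exec_instr [NConst 9 1, NConst 5 0] s"
  have "runs_within (While (NLess 5 1) ?body) ?s ((q - 0) * (14 + 1) + 1)
      (\<lambda>s'. \<exists>i. I i s' \<and> \<not> eval_test (NLess 5 1) s')"
  proof (rule runs_within_While)
    show "I 0 ?s" by (simp add: I_def)
    fix i s' assume I: "I i s'" and "eval_test (NLess 5 1) s'"
    then have i: "i < q" using q by (simp add: I_def)
    define c where "c = nreg s' 9"
    have c: "c \<le> 1" "Suc w div m ^ i = w div m ^ i + c" using I by (auto simp: I_def c_def)
    have x: "narr s' 3 i = w div m ^ i mod m" using I dig i by (simp add: I_def digit_def)
    have div: "Suc w div m ^ Suc i = (w div m ^ i + c) div m" "w div m ^ Suc i = w div m ^ i div m"
      "digit m (Suc w) i = (w div m ^ i + c) mod m"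
      using c(2) by (simp_all only: power_Suc2 div_mult2_eq digit_def)
    note carry = add_carry_div_mod[OF m(2) c(1), of "w div m ^ i"]
    have "runs_within ?body s' 14 (I (Suc i))"
      apply (rule runs_within_Seq[where ?T1.0 = 4 and ?T2.0 = 10])
       apply (rule runs_within_block)
        apply (rule runs_within_Seq[where ?T1.0 = "Suc 3" and ?T2.0 = 6])
         apply (rule runs_within_Cond; rule runs_within_block; (rule runs_within_block)?)
      using I i x m(1) carry c(1)
      by (auto simp: I_def less_Suc_eq div simp del: power_Suc simp flip: c_def)
    with i show "i < q \<and> runs_within ?body s' 14 (I (Suc i))" ..
  qed
  then have "runs_within (While (NLess 5 1) ?body) ?s ((q - 0) * (14 + 1) + 1) ?Q"
  proof (rule runs_within_mono)
    fix s' assume "\<exists>i. I i s' \<and> \<not> eval_test (NLess 5 1) s'"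
    then obtain i where I: "I i s'" "\<not> eval_test (NLess 5 1) s'" by blast
    then have i: "i = q" using q by (simp add: I_def)
    have "Suc w div m ^ q = nreg s' 9" "nreg s' 9 \<le> 1" using I(1) i w by (simp_all add: I_def)
    moreover have "Suc w div m ^ q = (if Suc w < m ^ q then 0 else 1)"
    proof (cases "Suc w < m ^ q")
      case False
      with w have "Suc w = m ^ q" by simp
      with False show ?thesis by (metis div_self nat.distinct(1))
    qed simp
    ultimately show "?Q s'" using I(1) i by (simp add: I_def)
  qed simp
  then show ?thesis
    unfolding successor_def by (intro runs_within_Seq[OF runs_within_block[where T = 3]]) auto
qed

section \<open>Farthest-first traversal\<close>

locale kcenter_instance = Metric_space "{..<n}" \<rho> for n :: nat and \<rho> +
  fixes k :: nat and \<epsilon> :: real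
  assumes n: "n \<ge> 1" and k: "k \<ge> 1" and \<epsilon>: "\<epsilon> > 0"
begin

text \<open>The cap keeps tuples no longer than \<open>n\<close>, so that one candidate is handled
  in time polynomial in \<open>n\<close> however large \<open>k\<close> is. Neither feasibility nor
  the optimum changes.\<close>

definition K :: nat where "K = min k n"

abbreviation opt :: real where "opt \<equiv> kcenter_opt {..<n} \<rho> k"

lemma K: "1 \<le> K" "K \<le> n"
  using n k by (auto simp: K_def)

lemma feasible_K: "kcenter_feasible {..<n} K C \<longleftrightarrow> kcenter_feasible {..<n} k C"
  unfolding K_def by (rule kcenter_feasible_min)

lemma opt_K: "kcenter_opt {..<n} \<rho> K = opt"
  by (simp add: kcenter_opt_def feasible_K)

text \<open>The covering condition bounds the cost from above; the witness \<open>f\<close>, at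
  distance at least \<open>r\<close> from every center, bounds it from below.\<close>

lemma cost_farthest_from:
  assumes "farthest_from n \<rho> A q f r" "q \<ge> 1"
  shows "kcenter_cost {..<n} \<rho> (A ` {..<q}) = r"
proof -
  have le: "kcenter_cost {..<n} \<rho> (A ` {..<q}) \<le> r' \<longleftrightarrow> (\<forall>u<n. \<exists>j<q. \<rho> u (A j) \<le> r')" for r'
    using n assms(2) by (subst kcenter_cost_le_iff) (auto simp: lessThan_empty_iff)
  have "kcenter_cost {..<n} \<rho> (A ` {..<q}) \<le> r"
    using le assms(1) by (simp add: farthest_from_def)
  moreover have "r \<le> kcenter_cost {..<n} \<rho> (A ` {..<q})"
    using le[of "kcenter_cost {..<n} \<rho> (A ` {..<q})"] assms(1)
    by (auto simp: farthest_from_def) (meson order_trans)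
  ultimately show ?thesis by simp
qed

lemma farthest_K:
  assumes "r \<in> {1, 8}" "nreg s r = q" "q \<ge> 1" "nreg s 0 = n" "\<forall>i<q. narr s a i < n" "distance_matrix n \<rho> s"
  shows "runs_within (farthest a r) s (34 * n * q) (\<lambda>s'. agree {3, 4, 5, 6, 7} {1, 2, 3} s s' \<and>
    farthest_from n \<rho> (narr s a) q (nreg s' 7) (rreg s' 3))"
  using assms n by (intro runs_within_farthest) auto

text \<open>With no points there is no covering radius, so \<open>m = 0\<close> only fixes the first
  point to be added. The arrays other than the net are kept at zero because the enumeration starts
  from their zero contents.\<close>

definition traversed :: "nat \<Rightarrow> store \<Rightarrow> bool" where
  "traversed m s \<longleftrightarrow> nreg s 0 = n \<and> nreg s 1 = K \<and> nreg s 8 = m \<and> rreg s 0 = \<epsilon> \<and> distance_matrix n \<rho> s \<and>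
     (\<forall>a. a \<noteq> 1 \<longrightarrow> narr s a = (\<lambda>_. 0)) \<and> (\<forall>i<m. narr s 1 i < n) \<and>
     (\<forall>j<m. \<forall>i<j. rreg s 3 \<le> \<rho> (narr s 1 i) (narr s 1 j)) \<and>
     (m = 0 \<longrightarrow> nreg s 7 = 0) \<and>
     (m > 0 \<longrightarrow> narr s 1 0 = 0 \<and> farthest_from n \<rho> (narr s 1) m (nreg s 7) (rreg s 3))"

text \<open>The new point is at least the old radius away from all earlier ones. Separation by that
  old radius is exported too, because it is the radius that the loop test has compared with the
  threshold.\<close>

lemma traversed_add_farthest:
  assumes s: "traversed m s" and m: "m < n"
  shows "runs_within add_farthest s (38 * n * n) (\<lambda>s'. traversed (Suc m) s' \<and>
    (\<forall>i<m. narr s' 1 i = narr s 1 i) \<and> rreg s' 4 = rreg s 4 \<and>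
    (\<forall>j\<le>m. \<forall>i<j. rreg s 3 \<le> \<rho> (narr s' 1 i) (narr s' 1 j)))"
proof -
  let ?s = "fold exec_instr [NStore 1 8 7, NConst 6 1, NAdd 8 8 6] s"
  let ?N = "(narr s 1)(m := nreg s 7)"
  have f: "nreg s 7 < n" using s n by (auto simp: traversed_def farthest_from_def split: if_splits)
  have st: "nreg ?s 0 = n" "nreg ?s 1 = K" "nreg ?s 8 = Suc m" "rreg ?s = rreg s"
    "narr ?s 1 = ?N" "\<forall>a. a \<noteq> 1 \<longrightarrow> narr ?s a = (\<lambda>_. 0)" "distance_matrix n \<rho> ?s"
    using s by (auto simp: traversed_def distance_matrix_def)
  have pts: "?N i < n" if "i < Suc m" for i
    using that f s by (auto simp: traversed_def)
  have sep: "rreg s 3 \<le> \<rho> (?N i) (?N j)" if "i < j" "j < Suc m" for i j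
    using that s f commute by (auto simp: traversed_def farthest_from_def less_Suc_eq split: if_splits)
  have N0: "?N 0 = 0" using s by (auto simp: traversed_def split: if_splits)
  have "runs_within (farthest 1 8) ?s (34 * n * Suc m) (\<lambda>s'. agree {3, 4, 5, 6, 7} {1, 2, 3} ?s s' \<and>
    farthest_from n \<rho> (narr ?s 1) (Suc m) (nreg s' 7) (rreg s' 3))"
    by (rule farthest_K) (use st pts in auto)
  then have *: "runs_within (farthest 1 8) ?s (34 * n * Suc m) (\<lambda>s'. traversed (Suc m) s' \<and>
    (\<forall>i<m. narr s' 1 i = narr s 1 i) \<and> rreg s' 4 = rreg s 4 \<and>
    (\<forall>j\<le>m. \<forall>i<j. rreg s 3 \<le> \<rho> (narr s' 1 i) (narr s' 1 j)))"
  proof (rule runs_within_mono)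
    fix s' assume "agree {3, 4, 5, 6, 7} {1, 2, 3} ?s s' \<and>
      farthest_from n \<rho> (narr ?s 1) (Suc m) (nreg s' 7) (rreg s' 3)"
    then have a: "agree {3, 4, 5, 6, 7} {1, 2, 3} ?s s'"
      and ff: "farthest_from n \<rho> ?N (Suc m) (nreg s' 7) (rreg s' 3)" using st(5) by auto
    from a st s have s': "nreg s' 0 = n" "nreg s' 1 = K" "nreg s' 8 = Suc m" "rreg s' 0 = \<epsilon>"
      "rreg s' 4 = rreg s 4" "narr s' 1 = ?N" "\<forall>a. a \<noteq> 1 \<longrightarrow> narr s' a = (\<lambda>_. 0)" "distance_matrix n \<rho> s'"
      by (auto simp: agree_def distance_matrix_def traversed_def)
    \<comment> \<open>The new farthest point was within the old radius of some old net point, which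
      is still in the net. For \<open>m = 0\<close> there are no pairs to separate.\<close>
    have rad: "rreg s' 3 \<le> rreg s 3" if "m > 0"
    proof -
      from that s obtain j where j: "j < m" "\<rho> (nreg s' 7) (narr s 1 j) \<le> rreg s 3"
        using ff by (auto simp: traversed_def farthest_from_def)
      moreover have "\<forall>j<Suc m. rreg s' 3 \<le> \<rho> (nreg s' 7) (?N j)"
        using ff unfolding farthest_from_def by blast
      from this[rule_format, of j] j(1) have "rreg s' 3 \<le> \<rho> (nreg s' 7) (narr s 1 j)" by simp
      ultimately show ?thesis by simp
    qed
    have "rreg s' 3 \<le> \<rho> (?N i) (?N j)" if "i < j" "j < Suc m" for i j
      using sep[OF that] rad that by linarith
    then have "traversed (Suc m) s'"
      using s' pts ff N0 unfolding traversed_def by (simp del: fun_upd_apply)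
    then show "traversed (Suc m) s' \<and>
      (\<forall>i<m. narr s' 1 i = narr s 1 i) \<and> rreg s' 4 = rreg s 4 \<and>
      (\<forall>j\<le>m. \<forall>i<j. rreg s 3 \<le> \<rho> (narr s' 1 i) (narr s' 1 j))"
      using s' sep by (simp add: less_Suc_eq_le)
  qed simp
  have "34 * n * Suc m \<le> 34 * n * n" using m by (intro mult_left_mono) auto
  moreover have "4 \<le> 4 * n * n" using n by simp
  ultimately have "4 + 34 * n * Suc m \<le> 38 * n * n" by simp
  with * show ?thesis
    unfolding add_farthest_def by (intro runs_within_Seq[OF runs_within_block[where T = 4]]) auto
qed

section \<open>Size of the net\<close>

definition net_bound :: real where
  "net_bound = real K * (min \<epsilon> (1 / 2)) powr (- (4 * doubling_dimension {..<n} \<rho>))"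

lemma dim: "doubling_bound {..<n} \<rho> (doubling_dimension {..<n} \<rho>)" "doubling_dimension {..<n} \<rho> \<ge> 0"
proof -
  have ne: "{..<n} \<noteq> {}" using n by (simp add: lessThan_empty_iff)
  show 1: "doubling_bound {..<n} \<rho> (doubling_dimension {..<n} \<rho>)"
    by (rule doubling_dimension_least(1)[OF Metric_space_axioms _ ne]) simp
  show "doubling_dimension {..<n} \<rho> \<ge> 0"
    using doubling_bound_nonneg[OF 1, of 0] n by simp
qed

text \<open>For \<open>m = K\<close> the estimate is trivial, as the packing factor is at least 1.
  Otherwise \<open>packing_bound\<close> applies with the first \<open>K\<close> points as ball
  centers; \<open>4 \<le> 2 ^ j * \<epsilon>\<close> is its condition on \<open>j\<close> for
  separation \<open>\<epsilon> * (r / 2)\<close>. Separation also makes \<open>N\<close> injective,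
  whence \<open>m \<le> n\<close>.\<close>

lemma net_size:
  assumes N: "\<forall>i<m. N i < n" and cover: "\<forall>u<n. \<exists>j<K. \<rho> u (N j) \<le> r"
    and sep: "m = K \<or> (\<forall>j<m. \<forall>i<j. \<epsilon> * (r / 2) < \<rho> (N i) (N j))" and m: "K \<le> m"
  shows "real m \<le> net_bound" "m \<le> n"
proof -
  obtain j where j: "4 \<le> 2 ^ j * \<epsilon>" "(2 powr doubling_dimension {..<n} \<rho>) ^ j \<le>
      (min \<epsilon> (1 / 2)) powr (- (4 * doubling_dimension {..<n} \<rho>))"
    using powr_halving_bound[OF \<epsilon> dim(2)] .
  have one: "1 \<le> (2 powr doubling_dimension {..<n} \<rho>) ^ j"
    using dim(2) by (intro one_le_power ge_one_powr_ge_zero) auto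
  have r0: "r \<ge> 0"
  proof -
    obtain i where "\<rho> 0 (N i) \<le> r" using cover n by (metis One_nat_def Suc_le_lessD)
    with nonneg[of 0 "N i"] show ?thesis by linarith
  qed
  have "real m \<le> real K * (2 powr doubling_dimension {..<n} \<rho>) ^ j \<and> m \<le> n"
  proof (cases "m = K")
    case True
    with one K show ?thesis by (simp add: mult_le_cancel_left1)
  next
    case False
    then have sp: "\<epsilon> * (r / 2) < \<rho> (N i) (N j)" if "i < j" "j < m" for i j using sep that by blast
    then have sp': "\<epsilon> * (r / 2) < \<rho> (N i) (N j)" if "i \<noteq> j" "i < m" "j < m" for i j
      using that commute by (metis nat_neq_iff)
    have t0: "0 \<le> \<epsilon> * (r / 2)" using \<epsilon> r0 by simp
    have inj: "inj_on N {..<m}"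
    proof (intro inj_onI, rule ccontr)
      fix i j assume ij: "i \<in> {..<m}" "j \<in> {..<m}" "N i = N j" "i \<noteq> j"
      then have "\<rho> (N i) (N j) = 0" using N by simp
      with sp'[of i j] ij t0 show False by simp
    qed
    have cardN: "card (N ` {..<m}) = m" using card_image[OF inj] by simp
    have sub: "N ` {..<m} \<subseteq> {..<n}" using N by auto
    have mn: "m \<le> n" using card_mono[OF finite_lessThan sub] cardN by simp
    \<comment> \<open>For \<open>r = 0\<close>, the point with index \<open>K\<close> would be at
      distance 0 from one of the first \<open>K\<close> points, against the strict
      separation.\<close>
    have rpos: "r > 0"
    proof (rule ccontr)
      assume "\<not> r > 0"
      with r0 have "r = 0" by simp
      have Km: "K < m" using False m by simp
      then obtain j where "j < K" "\<rho> (N K) (N j) \<le> r" using cover N by blast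
      with sp[of j K] Km \<open>r = 0\<close> commute[of "N K" "N j"] show False by simp
    qed
    have "real (card (N ` {..<m})) \<le>
        real (card (N ` {..<K})) * (2 powr doubling_dimension {..<n} \<rho>) ^ j"
    proof (rule packing_bound[OF dim(1) rpos])
      have "4 * r \<le> (2 ^ j * \<epsilon>) * r" using j(1) rpos by (intro mult_right_mono) auto
      then show "2 * (r / 2 ^ j) \<le> \<epsilon> * (r / 2)" by (simp add: field_simps)
      show "\<exists>b\<in>N ` {..<K}. \<rho> x b \<le> r" if "x \<in> N ` {..<m}" for x
        using that cover N by auto
      show "\<epsilon> * (r / 2) < \<rho> x y" if "x \<in> N ` {..<m}" "y \<in> N ` {..<m}" "x \<noteq> y" for x y
        using that sp' by (metis imageE lessThan_iff)
    qed (use N m in auto)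
    also have "\<dots> \<le> real K * (2 powr doubling_dimension {..<n} \<rho>) ^ j"
      using card_image_le[of "{..<K}" N] by (intro mult_right_mono) auto
    finally show ?thesis using cardN mn by simp
  qed
  moreover have "real K * (2 powr doubling_dimension {..<n} \<rho>) ^ j \<le> net_bound"
    unfolding net_bound_def using j(2) by (intro mult_left_mono) auto
  ultimately show "real m \<le> net_bound" "m \<le> n" by auto
qed

definition net :: "nat \<Rightarrow> store \<Rightarrow> bool" where
  "net m s \<longleftrightarrow> nreg s 0 = n \<and> nreg s 1 = K \<and> nreg s 8 = m \<and> distance_matrix n \<rho> s \<and>
     (\<forall>a. a \<noteq> 1 \<longrightarrow> narr s a = (\<lambda>_. 0)) \<and> narr s 1 0 = 0 \<and> (\<forall>i<m. narr s 1 i < n) \<and>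
     (\<forall>u<n. \<exists>j<m. \<rho> u (narr s 1 j) \<le> \<epsilon> * opt) \<and> K \<le> m \<and> m \<le> n \<and> real m \<le> net_bound"

text \<open>Both loops together add at most \<open>n\<close> points, each in time quadratic in
  \<open>n\<close>. Here \<open>r\<close> is the radius after \<open>K\<close> points, which fixes
  the threshold for the second loop.\<close>

lemma runs_within_traversal:
  assumes s: "traversed 0 s"
  shows "runs_within traversal s (82 * n * n * n) (\<lambda>s'. \<exists>m. net m s')"
proof -
  define B where "B = 38 * n * n"
  have phase1: "runs_within (While (NLess 8 1) add_farthest) s ((K - 0) * (B + 1) + 1)
      (\<lambda>s'. traversed K s')"
  proof (rule runs_within_mono)
    show "runs_within (While (NLess 8 1) add_farthest) s ((K - 0) * (B + 1) + 1)
      (\<lambda>s'. \<exists>w'. (traversed w' s' \<and> w' \<le> K) \<and> \<not> eval_test (NLess 8 1) s')"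
    proof (rule runs_within_While)
      fix w s' assume w: "traversed w s' \<and> w \<le> K" and "eval_test (NLess 8 1) s'"
      then have "w < K" by (simp add: traversed_def)
      moreover from this K have "w < n" by simp
      ultimately show "w < K \<and> runs_within add_farthest s' B (\<lambda>s'. traversed (Suc w) s' \<and> Suc w \<le> K)"
        using traversed_add_farthest[of w s'] w unfolding B_def by (auto elim!: runs_within_mono)
    qed (use s in simp)
    fix s' assume "\<exists>w'. (traversed w' s' \<and> w' \<le> K) \<and> \<not> eval_test (NLess 8 1) s'"
    then obtain w where w: "traversed w s'" "w \<le> K" "\<not> eval_test (NLess 8 1) s'" by blast
    then have "w = K" by (auto simp: traversed_def)
    with w(1) show "traversed K s'" by simp
  qed simp
  have phase2: "runs_within (While (RLess 4 3) add_farthest)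
      (fold exec_instr [RConst 4 2, RDiv 4 3 4, RMul 4 0 4] s1) ((n - K) * (B + 1) + 1)
      (\<lambda>s'. \<exists>m. net m s')" if s1: "traversed K s1" for s1
  proof -
    let ?s = "fold exec_instr [RConst 4 2, RDiv 4 3 4, RMul 4 0 4] s1"
    define r where "r = rreg s1 3"
    define f where "f = nreg s1 7"
    have ff: "farthest_from n \<rho> (narr s1 1) K f r"
      using s1 K by (auto simp: traversed_def f_def r_def)
    have sepK: "r \<le> \<rho> (narr s1 1 i) (narr s1 1 j)" if "i < j" "j < K" for i j
      using s1 that by (auto simp: traversed_def r_def)
    \<comment> \<open>The \<open>K\<close> points are extended by the farthest point
      \<open>f\<close>, which is not yet in the net, to the \<open>K + 1\<close> points that the
      lemma requires.\<close>
    have "r \<le> 2 * kcenter_opt {..<n} \<rho> K"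
    proof (rule separated_le_twice_opt[where P = "(narr s1 1)(K := f)"])
      show "((narr s1 1)(K := f)) i \<in> {..<n}" if "i \<le> K" for i
        using that s1 ff by (auto simp: traversed_def farthest_from_def)
      show "r \<le> \<rho> (((narr s1 1)(K := f)) i) (((narr s1 1)(K := f)) j)" if "i < j" "j \<le> K" for i j
        using that sepK ff commute by (auto simp: farthest_from_def)
    qed (use K in auto)
    then have r: "\<epsilon> * (r / 2) \<le> \<epsilon> * opt" using \<epsilon> by (simp add: opt_K)
    \<comment> \<open>The first \<open>K\<close> points are only known to be at least
      \<open>r\<close> apart, which does not exceed the threshold if
      \<open>\<epsilon> \<ge> 2\<close>; hence the disjunct \<open>m = K\<close>. Once a round runs,
      the radius it starts from is above the threshold and separates all pairs.\<close>
    define I where "I m s' \<longleftrightarrow> traversed m s' \<and> K \<le> m \<and> rreg s' 4 = \<epsilon> * (r / 2) \<and>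
      (\<forall>u<n. \<exists>j<K. \<rho> u (narr s' 1 j) \<le> r) \<and>
      (m = K \<or> (\<forall>j<m. \<forall>i<j. \<epsilon> * (r / 2) < \<rho> (narr s' 1 i) (narr s' 1 j)))" for m s'
    have size: "real m \<le> net_bound" "m \<le> n" if "I m s'" for m s'
      using net_size[of m "narr s' 1" r] that unfolding I_def traversed_def by blast+
    have "runs_within (While (RLess 4 3) add_farthest) ?s ((n - K) * (B + 1) + 1)
      (\<lambda>s'. \<exists>m. I m s' \<and> \<not> eval_test (RLess 4 3) s')"
    proof (rule runs_within_While)
      have "traversed K ?s" using s1 by (simp add: traversed_def distance_matrix_def)
      then show "I K ?s" using ff s1 by (simp add: I_def farthest_from_def r_def traversed_def distance_matrix_def)
    next
      fix m s' assume I: "I m s'" and "eval_test (RLess 4 3) s'"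
      then have gt: "\<epsilon> * (r / 2) < rreg s' 3" by (simp add: I_def)
      have "m \<le> n" using size(2)[OF I] .
      \<comment> \<open>Otherwise the \<open>n\<close> points at positive pairwise distances fill
        the space. The farthest point is then a net point, and the radius cannot be
        positive.\<close>
      have "m < n"
      proof (rule ccontr)
        assume "\<not> m < n"
        with \<open>m \<le> n\<close> have mn: "m = n" by simp
        from I have t: "traversed m s'" by (simp add: I_def)
        have m0: "m \<noteq> 0" using mn n by simp
        have "0 \<le> \<epsilon> * (r / 2)"
        proof -
          obtain j where "\<rho> f (narr s1 1 j) \<le> r" using ff K by (auto simp: farthest_from_def)
          with nonneg[of f "narr s1 1 j"] have "0 \<le> r" by linarith
          with \<epsilon> show ?thesis by simp
        qed
        with gt have pos: "rreg s' 3 > 0" by linarith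
        have sep: "rreg s' 3 \<le> \<rho> (narr s' 1 i) (narr s' 1 j)" if "i \<noteq> j" "i < m" "j < m" for i j
          using that t commute unfolding traversed_def by (metis nat_neq_iff)
        have inj: "inj_on (narr s' 1) {..<m}"
        proof (rule inj_onI, rule ccontr)
          fix i j assume ij: "i \<in> {..<m}" "j \<in> {..<m}" "narr s' 1 i = narr s' 1 j" "i \<noteq> j"
          then have "\<rho> (narr s' 1 i) (narr s' 1 j) = 0" using t by (auto simp: traversed_def)
          with sep[of i j] ij pos show False by simp
        qed
        moreover have "narr s' 1 ` {..<m} \<subseteq> {..<n}" using t by (auto simp: traversed_def)
        ultimately have "narr s' 1 ` {..<m} = {..<n}"
          using mn by (intro card_subset_eq) (auto simp: card_image)
        moreover have ff': "farthest_from n \<rho> (narr s' 1) m (nreg s' 7) (rreg s' 3)"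
          using t m0 by (simp add: traversed_def)
        ultimately have "nreg s' 7 \<in> narr s' 1 ` {..<m}" by (simp add: farthest_from_def)
        then obtain j where j: "j < m" "nreg s' 7 = narr s' 1 j" by blast
        then have "rreg s' 3 \<le> \<rho> (nreg s' 7) (nreg s' 7)"
          using ff' by (metis farthest_from_def)
        with pos ff' show False by (simp add: farthest_from_def)
      qed
      moreover have "runs_within add_farthest s' B (I (Suc m))"
      proof (rule runs_within_mono[OF traversed_add_farthest])
        fix s'' assume s'': "traversed (Suc m) s'' \<and> (\<forall>i<m. narr s'' 1 i = narr s' 1 i) \<and>
          rreg s'' 4 = rreg s' 4 \<and> (\<forall>j\<le>m. \<forall>i<j. rreg s' 3 \<le> \<rho> (narr s'' 1 i) (narr s'' 1 j))"
        have "\<exists>j<K. \<rho> u (narr s'' 1 j) \<le> r" if "u < n" for u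
          using I s'' that unfolding I_def by (metis order_less_le_trans)
        moreover have "\<epsilon> * (r / 2) < \<rho> (narr s'' 1 i) (narr s'' 1 j)" if "i < j" "j < Suc m" for i j
          using s'' gt that by (meson less_Suc_eq_le order_less_le_trans)
        ultimately show "I (Suc m) s''" using I s'' by (simp add: I_def)
      qed (use I \<open>m < n\<close> in \<open>auto simp: I_def B_def\<close>)
      ultimately show "m < n \<and> runs_within add_farthest s' B (I (Suc m))" by blast
    qed
    then show ?thesis
    proof (rule runs_within_mono)
      fix s' assume "\<exists>m. I m s' \<and> \<not> eval_test (RLess 4 3) s'"
      then obtain m where I: "I m s'" and "\<not> eval_test (RLess 4 3) s'" by blast
      then have le: "rreg s' 3 \<le> \<epsilon> * (r / 2)" by (simp add: I_def)
      from I have "m \<noteq> 0" using K by (auto simp: I_def)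
      with I have ff': "farthest_from n \<rho> (narr s' 1) m (nreg s' 7) (rreg s' 3)"
        by (simp add: I_def traversed_def)
      have "\<exists>j<m. \<rho> u (narr s' 1 j) \<le> \<epsilon> * opt" if "u < n" for u
        using ff' that le r unfolding farthest_from_def by (meson order_trans)
      then show "\<exists>m. net m s'"
        using I size[OF I] \<open>m \<noteq> 0\<close> by (intro exI[of _ m]) (auto simp: net_def I_def traversed_def)
    qed simp
  qed
  have rest: "runs_within (Seq (block [RConst 4 2, RDiv 4 3 4, RMul 4 0 4]) (While (RLess 4 3) add_farthest)) s1
      (4 + ((n - K) * (B + 1) + 1)) (\<lambda>s'. \<exists>m. net m s')" if "traversed K s1" for s1
    by (rule runs_within_Seq[OF _ order_refl], rule runs_within_block, rule phase2[OF that]) simp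
  have "(K - 0) * (B + 1) + 1 + (4 + ((n - K) * (B + 1) + 1)) = n * (B + 1) + 6"
  proof -
    have "K * (B + 1) + (n - K) * (B + 1) = n * (B + 1)"
      using K(2) by (metis add_mult_distrib le_add_diff_inverse)
    then show ?thesis by simp
  qed
  also have "\<dots> \<le> 82 * n * n * n"
  proof -
    have "1 \<le> n * n" "n \<le> n * (n * n)" "1 \<le> n * (n * n)" using n by simp_all
    then have "38 * (n * (n * n)) + n + 6 \<le> 82 * (n * (n * n))" by linarith
    then show ?thesis by (simp add: B_def algebra_simps)
  qed
  finally show ?thesis
    unfolding traversal_def
    by (intro runs_within_Seq[OF runs_within_mono[OF phase1 order_refl rest]])
qed

end

section \<open>Correctness and running time\<close>

context kcenter_instance
begin

text \<open>After all \<open>m ^ K\<close> rounds the stored cost is at most that of every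
  candidate, among them the rounded optimal solution of \<open>net_contains_approx\<close>, whose
  loss is at most \<open>\<epsilon> * opt\<close>.\<close>

lemma runs_within_enumeration:
  assumes net: "net m s0"
  shows "runs_within enumeration s0 (110 * n * n * m ^ K) (\<lambda>s'. nreg s' 1 = K \<and>
    (\<forall>i<K. narr s' 0 i < n) \<and>
    kcenter_cost {..<n} \<rho> (narr s' 0 ` {..<K}) \<le> (1 + \<epsilon>) * opt)" (is "runs_within _ _ _ ?Q")
proof -
  define N where "N = narr s0 1"
  define cost where "cost C = kcenter_cost {..<n} \<rho> C" for C
  define cand where "cand w = (\<lambda>i. N (digit m w i)) ` {..<K}" for w
  have s0: "nreg s0 0 = n" "nreg s0 1 = K" "nreg s0 8 = m" "distance_matrix n \<rho> s0"
    "\<And>a. a \<noteq> 1 \<Longrightarrow> narr s0 a = (\<lambda>_. 0)" "N 0 = 0" "\<And>i. i < m \<Longrightarrow> N i < n"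
    "\<And>u. u < n \<Longrightarrow> \<exists>j<m. \<rho> u (N j) \<le> \<epsilon> * opt" "K \<le> m"
    using net by (auto simp: net_def N_def)
  have m: "m \<ge> 1" using s0(9) K(1) by simp
  \<comment> \<open>The candidate arrays are constrained only for \<open>w < m ^ K\<close>: after
    the last tuple the odometer has wrapped around, and the carry in register 9 stops the
    loop.\<close>
  define I where "I w s \<longleftrightarrow> nreg s 0 = n \<and> nreg s 1 = K \<and> nreg s 8 = m \<and> nreg s 10 = 1 \<and>
    distance_matrix n \<rho> s \<and> narr s 1 = N \<and> (\<forall>i<K. narr s 0 i < n) \<and>
    rreg s 5 = cost (narr s 0 ` {..<K}) \<and> (\<forall>w'<w. rreg s 5 \<le> cost (cand w')) \<and>
    w \<le> m ^ K \<and> nreg s 9 = (if w < m ^ K then 0 else 1) \<and>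
    (w < m ^ K \<longrightarrow> (\<forall>i<K. narr s 3 i = digit m w i \<and> narr s 2 i = N (digit m w i)))" for w s
  define B where "B = 66 * n * n"
  let ?update = "Cond (RLess 3 5) (Seq (block [RConst 5 0, RAdd 5 5 3]) copy) (block [])"
  let ?body = "Seq (farthest 2 1) (Seq ?update successor)"
  have step: "w < m ^ K \<and> runs_within ?body s B (I (Suc w))"
    if I: "I w s" and t: "eval_test (NLess 9 10) s" for w s
  proof -
    have w: "w < m ^ K" using I t by (auto simp: I_def split: if_splits)
    have dig: "\<forall>i<K. narr s 3 i = digit m w i" "\<forall>i<K. narr s 2 i = N (digit m w i)"
      using I w by (auto simp: I_def)
    have C2: "\<forall>i<K. narr s 2 i < n" using dig(2) digit_less m s0(7) by simp
    have cand: "narr s 2 ` {..<K} = cand w"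
      unfolding cand_def using dig(2) by (intro image_cong) auto
    have 1: "runs_within (farthest 2 1) s (34 * n * K) (\<lambda>s1. agree {3, 4, 5, 6, 7} {1, 2, 3} s s1 \<and>
        rreg s1 3 = cost (cand w))"
    proof (rule runs_within_mono[OF farthest_K])
      fix s' assume "agree {3, 4, 5, 6, 7} {1, 2, 3} s s' \<and>
        farthest_from n \<rho> (narr s 2) K (nreg s' 7) (rreg s' 3)"
      then show "agree {3, 4, 5, 6, 7} {1, 2, 3} s s' \<and> rreg s' 3 = cost (cand w)"
        using cost_farthest_from[OF _ K(1)] cand unfolding cost_def by metis
    qed (use I K C2 in \<open>auto simp: I_def\<close>)
    have 2: "runs_within ?update s1 (6 * K + 7) (\<lambda>s2. (\<forall>x. x \<notin> {3, 4, 5, 6, 7} \<longrightarrow> nreg s2 x = nreg s x) \<and>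
        rarr s2 = rarr s \<and> (\<forall>a. a \<noteq> 0 \<longrightarrow> narr s2 a = narr s a) \<and> (\<forall>i<K. narr s2 0 i < n) \<and>
        rreg s2 5 = cost (narr s2 0 ` {..<K}) \<and> rreg s2 5 \<le> rreg s 5 \<and> rreg s2 5 \<le> cost (cand w))"
      (is "runs_within _ _ _ ?R")
      if s1: "agree {3, 4, 5, 6, 7} {1, 2, 3} s s1 \<and> rreg s1 3 = cost (cand w)" for s1
    proof -
      have e: "\<And>x. x \<notin> {3, 4, 5, 6, 7} \<Longrightarrow> nreg s1 x = nreg s x" "rreg s1 5 = rreg s 5"
        "narr s1 = narr s" "rarr s1 = rarr s" "rreg s1 3 = cost (cand w)"
        using s1 by (auto simp: agree_def)
      have "runs_within (Seq (block [RConst 5 0, RAdd 5 5 3]) copy) s1 (6 * K + 6) ?R"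
        if "rreg s1 3 < rreg s1 5"
      proof (rule runs_within_Seq[OF runs_within_block[where T = 3]])
        let ?s = "fold exec_instr [RConst 5 0, RAdd 5 5 3] s1"
        have "nreg ?s 1 = K" using e(1)[of 1] I by (simp add: I_def)
        then show "runs_within copy ?s (6 * K + 3) ?R"
        proof (rule runs_within_mono[OF runs_within_copy])
          fix s2 :: store assume s2: "(\<forall>x. x \<notin> {5, 6} \<longrightarrow> nreg s2 x = nreg ?s x) \<and> rreg s2 = rreg ?s \<and>
            rarr s2 = rarr ?s \<and> (\<forall>a. a \<noteq> 0 \<longrightarrow> narr s2 a = narr ?s a) \<and>
            (\<forall>i<K. narr s2 0 i = narr ?s 2 i)"
          then have eq: "\<forall>i<K. narr s2 0 i = narr s 2 i" using e(3) by simp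
          then have "narr s2 0 ` {..<K} = narr s 2 ` {..<K}" by (intro image_cong) auto
          with s2 e that eq C2 show "?R s2" by (simp add: cand)
        qed simp
      qed auto
      moreover have "runs_within (block []) s1 (6 * K + 6) ?R" if "\<not> rreg s1 3 < rreg s1 5"
        by (rule runs_within_block) (use that e I in \<open>simp_all add: I_def\<close>)
      ultimately have "runs_within ?update s1 (Suc (6 * K + 6)) ?R"
        by (rule runs_within_Cond[of "RLess 3 5" s1, unfolded eval_test.simps])
      then show ?thesis by (rule runs_within_mono) simp
    qed
    have 3: "runs_within successor s2 (15 * K + 4) (I (Suc w))" if s2: "?R s2" for s2
    proof (rule runs_within_mono[OF runs_within_successor[OF _ _ m w]])
      show "nreg s2 1 = K" "nreg s2 8 = m" "\<forall>i<K. narr s2 3 i = digit m w i"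
        using s2 I dig by (auto simp: I_def)
      fix s3 :: store assume s3: "(\<forall>x. x \<notin> {5, 6, 9, 11} \<longrightarrow> nreg s3 x = nreg s2 x) \<and> rreg s3 = rreg s2 \<and>
        rarr s3 = rarr s2 \<and> (\<forall>a. a \<notin> {2, 3} \<longrightarrow> narr s3 a = narr s2 a) \<and>
        nreg s3 9 = (if Suc w < m ^ K then 0 else 1) \<and>
        (\<forall>i<K. narr s3 3 i = digit m (Suc w) i \<and> narr s3 2 i = narr s2 1 (digit m (Suc w) i))"
      have best: "rreg s3 5 \<le> cost (cand w')" if "w' < Suc w" for w'
      proof (cases "w' = w")
        case False
        with that have "w' < w" by simp
        with I have "rreg s 5 \<le> cost (cand w')" unfolding I_def by blast
        with s2 s3 show ?thesis by (metis order_trans)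
      qed (use s2 s3 in simp)
      have "distance_matrix n \<rho> s3" using s2 s3 I by (simp add: distance_matrix_def I_def)
      then show "I (Suc w) s3" using s2 s3 I w best by (simp add: I_def)
    qed simp
    have "K \<le> n * n" "1 \<le> n * n" "n * K \<le> n * n"
      using K(2) n by (simp_all add: le_trans[OF K(2)])
    \<comment> \<open>The constant in \<open>B\<close> is 66 = 34 + 21 + 11.\<close>
    then have "34 * (n * K) + (21 * K + 11) \<le> 66 * (n * n)" by linarith
    then have "34 * n * K + (6 * K + 7 + (15 * K + 4)) \<le> B" by (simp add: B_def algebra_simps)
    moreover have "runs_within (Seq ?update successor) s1 (6 * K + 7 + (15 * K + 4)) (I (Suc w))"
      if "agree {3, 4, 5, 6, 7} {1, 2, 3} s s1 \<and> rreg s1 3 = cost (cand w)" for s1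
      by (rule runs_within_Seq[OF runs_within_mono[OF 2[OF that] order_refl 3] order_refl])
    ultimately have "runs_within ?body s B (I (Suc w))"
      by (intro runs_within_Seq[OF runs_within_mono[OF 1 order_refl]]) auto
    with w show ?thesis ..
  qed
  let ?init = "[RConst 5 0, RAdd 5 5 3, NConst 9 0, NConst 10 1]"
  have loop: "runs_within (While (NLess 9 10) ?body) (fold exec_instr ?init s)
      ((m ^ K - 0) * (B + 1) + 1) ?Q"
    if s: "agree {3, 4, 5, 6, 7} {1, 2, 3} s0 s"
      and ff: "farthest_from n \<rho> (narr s0 0) K (nreg s 7) (rreg s 3)" for s
  proof -
    let ?s = "fold exec_instr ?init s"
    have e: "\<And>x. x \<notin> {3, 4, 5, 6, 7} \<Longrightarrow> nreg s x = nreg s0 x" "narr s = narr s0" "rarr s = rarr s0"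
      using s by (auto simp: agree_def)
    have "distance_matrix n \<rho> ?s" using s0(4) e(3) by (simp add: distance_matrix_def)
    moreover have "rreg s 3 = cost (narr s0 0 ` {..<K})"
      unfolding cost_def using cost_farthest_from[OF ff K(1)] by simp
    \<comment> \<open>All arrays but the net are still zero. Thus array 0 is a valid solution
      consisting of point 0, array 3 holds the digits of 0, and array 2 is the matching candidate
      because \<open>N 0 = 0\<close>.\<close>
    ultimately have "I 0 ?s"
      using s0 e n m by (simp add: I_def digit_def N_def)
    from runs_within_While[of I, OF this step]
    have "runs_within (While (NLess 9 10) ?body) ?s ((m ^ K - 0) * (B + 1) + 1)
      (\<lambda>s'. \<exists>w. I w s' \<and> \<not> eval_test (NLess 9 10) s')" by blast
    then show ?thesis
    proof (rule runs_within_mono)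
      fix s' assume "\<exists>w. I w s' \<and> \<not> eval_test (NLess 9 10) s'"
      then obtain w where I: "I w s'" and "\<not> eval_test (NLess 9 10) s'" by blast
      then have w: "w = m ^ K" by (auto simp: I_def split: if_splits)
      have "\<exists>w' < m ^ K. cost (cand w') \<le> kcenter_opt {..<n} \<rho> K + \<epsilon> * opt"
        unfolding cost_def cand_def using s0 K n
        by (intro net_contains_approx) (auto simp: lessThan_empty_iff)
      then obtain w' where "w' < m ^ K" "cost (cand w') \<le> (1 + \<epsilon>) * opt"
        by (auto simp: opt_K algebra_simps)
      with I w have "rreg s' 5 \<le> (1 + \<epsilon>) * opt" unfolding I_def by (metis order_trans)
      with I show "?Q s'" by (simp add: I_def cost_def)
    qed simp
  qed
  have rest: "runs_within (Seq (block ?init) (While (NLess 9 10) ?body)) s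
      (5 + ((m ^ K - 0) * (B + 1) + 1)) ?Q"
    if "agree {3, 4, 5, 6, 7} {1, 2, 3} s0 s \<and>
      farthest_from n \<rho> (narr s0 0) K (nreg s 7) (rreg s 3)" for s
    by (rule runs_within_Seq[OF _ order_refl], rule runs_within_block, rule loop)
      (use that in simp_all)
  have far: "runs_within (farthest 0 1) s0 (34 * n * K) (\<lambda>s. agree {3, 4, 5, 6, 7} {1, 2, 3} s0 s \<and>
    farthest_from n \<rho> (narr s0 0) K (nreg s 7) (rreg s 3))"
    by (rule farthest_K) (use s0 K n in auto)
  have "runs_within enumeration s0 (34 * n * K + (5 + ((m ^ K - 0) * (B + 1) + 1))) ?Q"
    unfolding enumeration_def
    by (rule runs_within_Seq[OF runs_within_mono[OF far order_refl rest] order_refl])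
  then show ?thesis
  proof (rule runs_within_mono)
    define X where "X = m ^ K"
    have X: "X \<ge> 1" using m by (simp add: X_def)
    have "n * K \<le> n * n * X" using K(2) X by (metis mult.assoc mult.right_neutral mult_le_mono order_refl)
    moreover have "X \<le> n * n * X" "1 \<le> n * n * X" using n X by simp_all
    ultimately have "34 * (n * K) + 6 + (66 * (n * n * X) + X) \<le> 110 * (n * n * X)" by linarith
    then show "34 * n * K + (5 + ((m ^ K - 0) * (B + 1) + 1)) \<le> 110 * n * n * m ^ K"
      by (simp add: B_def algebra_simps flip: X_def)
  qed
qed

text \<open>The \<open>K\<close>-th power of \<open>net_bound\<close> has the desired form with
  \<open>K\<close> for \<open>k\<close>. Passing to \<open>k\<close> only enlarges it, since
  \<open>K \<le> k\<close>, the base \<open>e\<close> is at most 1 and the dimension is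
  nonnegative.\<close>

lemma net_power_bound:
  assumes "real m \<le> net_bound"
  shows "real (m ^ K) \<le>
    real k ^ k / (min \<epsilon> (1 / 2)) powr (4 * real k * doubling_dimension {..<n} \<rho>)"
proof -
  define e where "e = min \<epsilon> (1 / 2)"
  define \<delta> where "\<delta> = doubling_dimension {..<n} \<rho>"
  have e: "0 < e" "e \<le> 1" using \<epsilon> by (auto simp: e_def)
  have \<delta>: "\<delta> \<ge> 0" using dim(2) by (simp add: \<delta>_def)
  have Kk: "K \<le> k" by (simp add: K_def)
  have "real (m ^ K) \<le> (real K * e powr (- (4 * \<delta>))) ^ K"
    using assms by (simp add: net_bound_def e_def \<delta>_def power_mono)
  also have "\<dots> = real K ^ K * e powr (- (4 * \<delta>) * real K)"
    using e by (simp add: power_mult_distrib powr_power mult.commute)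
  also have "\<dots> \<le> real k ^ k * e powr (- (4 * real k * \<delta>))"
  proof (rule mult_mono)
    have "real K ^ K \<le> real k ^ K" using Kk by (intro power_mono) auto
    also have "\<dots> \<le> real k ^ k" using Kk k by (intro power_increasing) auto
    finally show "real K ^ K \<le> real k ^ k" .
    have "\<delta> * real K \<le> \<delta> * real k" using Kk \<delta> by (intro mult_left_mono) auto
    then show "e powr (- (4 * \<delta>) * real K) \<le> e powr (- (4 * real k * \<delta>))"
      using e by (intro powr_mono') (auto simp: algebra_simps)
  qed auto
  also have "\<dots> = real k ^ k / e powr (4 * real k * \<delta>)" by (simp add: powr_minus_divide)
  finally show ?thesis by (simp add: e_def \<delta>_def)
qed

lemma runs_within_kcenter_prog:
  "\<exists>m\<ge>1. real m \<le> net_bound \<and>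
    runs_within kcenter_prog (kcenter_input n \<rho> k \<epsilon>) (200 * n * n * n * m ^ K)
      (\<lambda>s. kcenter_approx {..<n} \<rho> k \<epsilon> (kcenter_output s))"
proof -
  let ?Q = "\<lambda>s. kcenter_approx {..<n} \<rho> k \<epsilon> (kcenter_output s)"
  let ?init = "Cond (NLess 0 1) (block [NConst 1 0, NAdd 1 1 0]) (block [])"
  have "u * n + v < n * n" if "u < n" "v < n" for u v
  proof -
    have "u * n + v < Suc u * n" using that by simp
    also have "\<dots> \<le> n * n" using that by (intro mult_right_mono) auto
    finally show ?thesis .
  qed
  then have init: "runs_within ?init (kcenter_input n \<rho> k \<epsilon>) (Suc 3) (traversed 0)"
    by (intro runs_within_Cond runs_within_block)
      (auto simp: traversed_def kcenter_input_def distance_matrix_def K_def fun_eq_iff)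
  have out: "?Q (fold exec_instr [NConst 0 0, NAdd 0 0 1] s)"
    if "nreg s 1 = K" "\<forall>i<K. narr s 0 i < n"
      "kcenter_cost {..<n} \<rho> (narr s 0 ` {..<K}) \<le> (1 + \<epsilon>) * opt" for s
  proof -
    have "kcenter_output (fold exec_instr [NConst 0 0, NAdd 0 0 1] s) = narr s 0 ` {..<K}"
      using that(1) by (simp add: kcenter_output_def)
    moreover have "kcenter_feasible {..<n} K (narr s 0 ` {..<K})"
      using that(2) K card_image_le[of "{..<K}" "narr s 0"]
      by (auto simp: kcenter_feasible_def lessThan_empty_iff)
    ultimately show ?thesis using that(3) by (simp add: kcenter_approx_def feasible_K)
  qed
  have finish: "runs_within (Seq enumeration (block [NConst 0 0, NAdd 0 0 1])) s
      (110 * n * n * m ^ K + 3) ?Q" if "net m s" for m s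
    by (rule runs_within_Seq[OF runs_within_mono[OF runs_within_enumeration[OF that] order_refl] order_refl])
      (intro runs_within_block out, auto)
  \<comment> \<open>The net size \<open>m\<close> is determined only by the run, yet the total time
    depends on it. Making the first two runs explicit fixes one \<open>m\<close> for both the time
    and the size bound.\<close>
  obtain t s1 where 1: "runs ?init (kcenter_input n \<rho> k \<epsilon>) t s1" "t \<le> Suc 3" "traversed 0 s1"
    using init unfolding runs_within_def by blast
  obtain t' s2 m where 2: "runs traversal s1 t' s2" "t' \<le> 82 * n * n * n" "net m s2"
    using runs_within_traversal[OF 1(3)] unfolding runs_within_def by blast
  have "runs_within kcenter_prog (kcenter_input n \<rho> k \<epsilon>)
      (Suc 3 + (82 * n * n * n + (110 * n * n * m ^ K + 3))) ?Q"
    unfolding kcenter_prog_def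
  proof (rule runs_within_Seq[OF _ order_refl])
    show "runs_within ?init (kcenter_input n \<rho> k \<epsilon>) (Suc 3) (\<lambda>s. runs_within
      (Seq traversal (Seq enumeration (block [NConst 0 0, NAdd 0 0 1]))) s
      (82 * n * n * n + (110 * n * n * m ^ K + 3)) ?Q)"
      unfolding runs_within_def[of ?init]
    proof (intro exI conjI)
      show "runs_within (Seq traversal (Seq enumeration (block [NConst 0 0, NAdd 0 0 1]))) s1
        (82 * n * n * n + (110 * n * n * m ^ K + 3)) ?Q"
      proof (rule runs_within_Seq[OF _ order_refl])
        show "runs_within traversal s1 (82 * n * n * n) (\<lambda>s. runs_within
          (Seq enumeration (block [NConst 0 0, NAdd 0 0 1])) s (110 * n * n * m ^ K + 3) ?Q)"
          unfolding runs_within_def[of traversal] using 2 finish by blast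
      qed
    qed (use 1 in auto)
  qed
  moreover have m: "m \<ge> 1" "real m \<le> net_bound" using 2(3) K(1) by (auto simp: net_def)
  moreover have "Suc 3 + (82 * n * n * n + (110 * n * n * m ^ K + 3)) \<le> 200 * n * n * n * m ^ K"
  proof -
    define X where "X = m ^ K"
    have X: "X \<ge> 1" using m(1) by (simp add: X_def)
    have "n * (n * n) \<le> n * (n * n) * X" "1 \<le> n * (n * n) * X" using n X by simp_all
    moreover have "n * n * X \<le> n * (n * n) * X" using n by simp
    ultimately have "82 * (n * (n * n)) + 110 * (n * n * X) + 7 \<le> 200 * (n * (n * n) * X)"
      by linarith
    then show ?thesis by (simp add: algebra_simps flip: X_def)
  qed
  ultimately show ?thesis by (meson runs_within_mono)
qed

text \<open>The constant 4 comes from the size of the net; 200 and the exponent 3 come from the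
  cubic overhead per candidate and of the traversal.\<close>

lemma kcenter_prog_correct:
  "\<exists>t s. runs kcenter_prog (kcenter_input n \<rho> k \<epsilon>) t s \<and>
    real t \<le> kcenter_time_bound 4 200 3 n k \<epsilon> (doubling_dimension {..<n} \<rho>) \<and>
    kcenter_approx {..<n} \<rho> k \<epsilon> (kcenter_output s)"
proof -
  obtain m t s where m: "real m \<le> net_bound"
    and t: "runs kcenter_prog (kcenter_input n \<rho> k \<epsilon>) t s" "t \<le> 200 * n * n * n * m ^ K"
      "kcenter_approx {..<n} \<rho> k \<epsilon> (kcenter_output s)"
    using runs_within_kcenter_prog unfolding runs_within_def by blast
  have "real t \<le> real (200 * n * n * n * m ^ K)" using t(2) by (rule of_nat_mono)
  also have "\<dots> = real (m ^ K) * (200 * real n powr 3)"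
    using n by (simp add: powr_numeral power3_eq_cube)
  also have "\<dots> \<le> kcenter_time_bound 4 200 3 n k \<epsilon> (doubling_dimension {..<n} \<rho>)"
    unfolding kcenter_time_bound_def using net_power_bound[OF m] by (intro mult_right_mono) auto
  finally show ?thesis using t by blast
qed

end

theorem theorem2:
  shows "\<exists>(p :: prog) (a :: real) (b :: real) (c :: real). a > 0 \<and> b > 0 \<and> c > 0 \<and>
    (\<forall>(n :: nat) (\<rho> :: nat \<Rightarrow> nat \<Rightarrow> real) (d :: real) (k :: nat) (\<epsilon> :: real).
       n \<ge> 1 \<and> Metric_space {..<n} \<rho> \<and> d = doubling_dimension {..<n} \<rho> \<and> k \<ge> 1 \<and> \<epsilon> > 0 \<longrightarrow>
       (\<exists>t s. runs p (kcenter_input n \<rho> k \<epsilon>) t s \<and>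
          real t \<le> kcenter_time_bound a b c n k \<epsilon> d \<and>
          kcenter_approx {..<n} \<rho> k \<epsilon> (kcenter_output s)))"
proof (rule exI[of _ kcenter_prog], rule exI[of _ 4], rule exI[of _ 200], rule exI[of _ 3],
    intro conjI allI impI)
  fix n k :: nat and \<rho> :: "nat \<Rightarrow> nat \<Rightarrow> real" and d \<epsilon> :: real
  assume *: "n \<ge> 1 \<and> Metric_space {..<n} \<rho> \<and> d = doubling_dimension {..<n} \<rho> \<and> k \<ge> 1 \<and> \<epsilon> > 0"
  then interpret kcenter_instance n \<rho> k \<epsilon>
    by (simp add: kcenter_instance_def kcenter_instance_axioms_def)
  show "\<exists>t s. runs kcenter_prog (kcenter_input n \<rho> k \<epsilon>) t s \<and>
      real t \<le> kcenter_time_bound 4 200 3 n k \<epsilon> d \<and>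
      kcenter_approx {..<n} \<rho> k \<epsilon> (kcenter_output s)"
    using kcenter_prog_correct * by simp
qed auto

end
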